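(* Let $d\ge1$, $p>1$, $\kappa\in\{0,1\}$ and $f,g\in\ell^{2,\kappa}(\mathbb{Z}^d)$. Then the Cauchy problem $$\partial_t^2u(x,t)-\Delta u(x,t)=-|u|^{p-1}u,\qquad u(x,0)=f(x),\quad \partial_tu(x,0)=g(x),\qquad x\in\mathbb{Z}^d,$$ has a global and unique classical solution, i.e. for every $T>0$ there is a unique solution $u\in C^2([0,T];\ell^{2,\kappa}(\mathbb{Z}^d))$.
   Context: $\Delta u(x)=\sum_{y\in\mathbb{Z}^d,\,|y-x|=1}(u(y)-u(x))$ is the discrete Laplacian on the lattice graph $\mathbb{Z}^d$. With $\langle m\rangle=(1+|m|^2)^{1/2}$, $\ell^{2,\kappa}(\mathbb{Z}^d)$ is the space of $f:\mathbb{Z}^d\to\mathbb{C}$ with $\|f\|_{\ell^{2,\kappa}}=\left(\sum_m|f(m)|^2\langle m\rangle^{2\kappa}\right)^{1/2}<\infty$. $C^2([0,T];B)$ denotes twice continuously differentiable maps from $[0,T]$ to the Banach space $B$. *)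

theory Defs
  imports "HOL-Analysis.Analysis"
begin

text \<open>The lattice of dimension \<open>d = CARD('d)\<close> is the type \<open>int ^ 'd\<close>; a finite index type is
  nonempty, so \<open>d \<ge> 1\<close>.\<close>

definition lattice_norm :: "int ^ 'd \<Rightarrow> real" where
  "lattice_norm m = norm ((\<chi> i. real_of_int (m $ i)) :: real ^ 'd)"

definition japanese_bracket :: "int ^ 'd \<Rightarrow> real" where
  "japanese_bracket m = sqrt (1 + (lattice_norm m)\<^sup>2)"

definition discrete_laplacian :: "(int ^ 'd \<Rightarrow> complex) \<Rightarrow> int ^ 'd \<Rightarrow> complex" where
  "discrete_laplacian u x = (\<Sum>y | lattice_norm (y - x) = 1. u y - u x)"

text \<open>The sum in the Laplacian is over a finite set, so it is not degenerate.\<close>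

lemma finite_lattice_neighbours: "finite {y :: int ^ 'd. lattice_norm (y - x) = 1}"
proof (rule finite_subset)
  let ?F = "PiE (UNIV :: 'd set) (\<lambda>i. {x $ i - 1 .. x $ i + 1})"
  show "finite (vec_lambda ` ?F)"
    by (intro finite_imageI finite_PiE) auto
  show "{y :: int ^ 'd. lattice_norm (y - x) = 1} \<subseteq> vec_lambda ` ?F"
  proof
    fix y :: "int ^ 'd"
    assume "y \<in> {y. lattice_norm (y - x) = 1}"
    then have n: "norm ((\<chi> i. real_of_int ((y - x) $ i)) :: real ^ 'd) = 1"
      by (simp add: lattice_norm_def)
    have "\<bar>y $ i - x $ i\<bar> \<le> 1" for i
    proof -
      have "\<bar>real_of_int ((y - x) $ i)\<bar> \<le> 1"
        using component_le_norm_cart[of "(\<chi> i. real_of_int ((y - x) $ i)) :: real ^ 'd" i] n by simp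
      then show ?thesis by simp
    qed
    then have "y $ i \<in> {x $ i - 1 .. x $ i + 1}" for i
      by (simp add: abs_le_iff algebra_simps)
    then have "vec_nth y \<in> ?F" by auto
    then show "y \<in> vec_lambda ` ?F" by (metis imageI vec_nth_inverse)
  qed
qed

definition weighted_l2 :: "real \<Rightarrow> (int ^ 'd \<Rightarrow> complex) set" where
  "weighted_l2 \<kappa> =
    {f. (\<lambda>m. (cmod (f m))\<^sup>2 * japanese_bracket m powr (2 * \<kappa>)) summable_on UNIV}"

definition weighted_l2_norm :: "real \<Rightarrow> (int ^ 'd \<Rightarrow> complex) \<Rightarrow> real" where
  "weighted_l2_norm \<kappa> f =
    sqrt (\<Sum>\<^sub>\<infinity>m. (cmod (f m))\<^sup>2 * japanese_bracket m powr (2 * \<kappa>))"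

text \<open>A space-time function \<open>u(x,t)\<close> is written in the curried form \<open>u t x\<close>, that is, as a curve
  in a space of functions on the lattice. The exponent \<open>\<kappa>\<close> is a term-level parameter, so the
  Banach space is given by a carrier and a norm, and continuity and
  differentiability of curves are taken in that norm, one-sided at the endpoints of the
  interval. The carrier conditions are essential: \<open>weighted_l2_norm\<close> is 0 (the default value
  of a divergent sum) outside the carrier.\<close>

definition weighted_l2_continuous_on ::
  "real \<Rightarrow> real set \<Rightarrow> (real \<Rightarrow> int ^ 'd \<Rightarrow> complex) \<Rightarrow> bool" where
  "weighted_l2_continuous_on \<kappa> S u \<longleftrightarrow>
    (\<forall>t\<in>S. u t \<in> weighted_l2 \<kappa>) \<and>
    (\<forall>t\<in>S. ((\<lambda>s. weighted_l2_norm \<kappa> (\<lambda>m. u s m - u t m)) \<longlongrightarrow> 0) (at t within S))"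

definition has_weighted_l2_derivative_on ::
  "real \<Rightarrow> real set \<Rightarrow> (real \<Rightarrow> int ^ 'd \<Rightarrow> complex) \<Rightarrow> (real \<Rightarrow> int ^ 'd \<Rightarrow> complex) \<Rightarrow> bool" where
  "has_weighted_l2_derivative_on \<kappa> S u v \<longleftrightarrow>
    (\<forall>t\<in>S. u t \<in> weighted_l2 \<kappa> \<and> v t \<in> weighted_l2 \<kappa>) \<and>
    (\<forall>t\<in>S. ((\<lambda>s. weighted_l2_norm \<kappa> (\<lambda>m. (u s m - u t m) /\<^sub>R (s - t) - v t m)) \<longlongrightarrow> 0)
            (at t within S))"

definition C2_weighted_l2 :: "real \<Rightarrow> real \<Rightarrow> (real \<Rightarrow> int ^ 'd \<Rightarrow> complex) set" where
  "C2_weighted_l2 \<kappa> T =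
    {u. \<exists>v w. has_weighted_l2_derivative_on \<kappa> {0..T} u v \<and>
              has_weighted_l2_derivative_on \<kappa> {0..T} v w \<and>
              weighted_l2_continuous_on \<kappa> {0..T} w}"

text \<open>The partial time derivative at a fixed lattice point, one-sided at \<open>0\<close> and \<open>T\<close>. For a curve
  in \<open>C2_weighted_l2\<close> it is the pointwise evaluation of the derivative in the norm, since
  convergence in the norm implies convergence at each lattice point.\<close>

definition time_derivative ::
  "real \<Rightarrow> (real \<Rightarrow> int ^ 'd \<Rightarrow> complex) \<Rightarrow> real \<Rightarrow> int ^ 'd \<Rightarrow> complex" where
  "time_derivative T u t x = vector_derivative (\<lambda>s. u s x) (at t within {0..T})"

definition is_classical_solution ::
  "real \<Rightarrow> real \<Rightarrow> (int ^ 'd \<Rightarrow> complex) \<Rightarrow> (int ^ 'd \<Rightarrow> complex) \<Rightarrow> real \<Rightarrow>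
    (real \<Rightarrow> int ^ 'd \<Rightarrow> complex) \<Rightarrow> bool" where
  "is_classical_solution p \<kappa> f g T u \<longleftrightarrow>
    u \<in> C2_weighted_l2 \<kappa> T \<and>
    (\<forall>t\<in>{0..T}. \<forall>x. time_derivative T (time_derivative T u) t x - discrete_laplacian (u t) x
        = - (of_real (cmod (u t x) powr (p - 1)) * u t x)) \<and>
    (\<forall>x. u 0 x = f x) \<and>
    (\<forall>x. time_derivative T u 0 x = g x)"

end

theory Submission
  imports Defs
begin

text \<open>With the weight \<open>w = japanese_bracket powr \<kappa>\<close>, the unknown \<open>x = w u\<close> lives in the unweighted
  \<open>\<ell>\<^sup>2\<close>, and the equation becomes a second-order equation there; the conjugated Laplacian is
  bounded because \<open>w\<close> changes by at most a constant factor between neighbours. If \<open>\<bar>u\<bar>\<close> is replaced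
  by \<open>min \<bar>u\<bar> R\<close> in the coefficient of the nonlinearity, then the right-hand side is globally Lipschitz
  and a global solution exists. The energy
  \<open>\<parallel>x'\<parallel>\<^sup>2/2 + \<parallel>x\<parallel>\<^sup>2/2 + \<Sum>m. w(m)\<^sup>2 \<Phi>(u(m))\<close>, with \<open>\<Phi>\<close> the potential of the truncated nonlinearity,
  grows at most exponentially at a rate that depends only on the Laplacian. Since \<open>w \<ge> 1\<close>, the
  supremum of \<open>\<bar>u\<bar>\<close> is bounded by \<open>\<parallel>x\<parallel>\<close>, so for large \<open>R\<close> the truncation is never active.
  Two classical solutions are bounded, hence solve the same truncated equation and coincide by
  Gronwall's inequality.\<close>

subsection \<open>The Hilbert space of square-summable functions\<close>

typedef 'a ell2 = "{f :: 'a \<Rightarrow> complex. (\<lambda>m. (cmod (f m))\<^sup>2) summable_on UNIV}"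
  morphisms ell2_nth Abs_ell2
  by (rule exI[of _ "\<lambda>_. 0"]) simp

setup_lifting type_definition_ell2

lemma ell2_eqI: "(\<And>m. ell2_nth x m = ell2_nth y m) \<Longrightarrow> x = y"
  by (metis ell2_nth_inject ext)

lemma ell2_nth_summable: "(\<lambda>m. (cmod (ell2_nth x m))\<^sup>2) summable_on UNIV"
  using ell2_nth[of x] by simp

lemma square_summable_add:
  fixes f g :: "'a \<Rightarrow> complex"
  assumes "(\<lambda>m. (cmod (f m))\<^sup>2) summable_on UNIV" "(\<lambda>m. (cmod (g m))\<^sup>2) summable_on UNIV"
  shows "(\<lambda>m. (cmod (f m + g m))\<^sup>2) summable_on UNIV"
proof (rule summable_on_comparison_test)
  show "(\<lambda>m. 2 * (cmod (f m))\<^sup>2 + 2 * (cmod (g m))\<^sup>2) summable_on UNIV"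
    by (intro summable_on_add summable_on_cmult_right assms)
  show "(cmod (f m + g m))\<^sup>2 \<le> 2 * (cmod (f m))\<^sup>2 + 2 * (cmod (g m))\<^sup>2" for m
  proof -
    have "(cmod (f m + g m))\<^sup>2 \<le> (cmod (f m) + cmod (g m))\<^sup>2"
      by (simp add: norm_triangle_ineq power_mono)
    also have "\<dots> \<le> 2 * (cmod (f m))\<^sup>2 + 2 * (cmod (g m))\<^sup>2"
      using sum_squares_ge_zero[of "cmod (f m) - cmod (g m)" 0]
      by (simp add: power2_eq_square algebra_simps)
    finally show ?thesis .
  qed
qed simp

instantiation ell2 :: (type) real_vector
begin

lift_definition zero_ell2 :: "'a ell2" is "\<lambda>_. 0" by simp
lift_definition uminus_ell2 :: "'a ell2 \<Rightarrow> 'a ell2" is "\<lambda>f m. - f m" by simp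
lift_definition plus_ell2 :: "'a ell2 \<Rightarrow> 'a ell2 \<Rightarrow> 'a ell2" is "\<lambda>f g m. f m + g m"
  by (rule square_summable_add)
lift_definition minus_ell2 :: "'a ell2 \<Rightarrow> 'a ell2 \<Rightarrow> 'a ell2" is "\<lambda>f g m. f m - g m"
  using square_summable_add[of _ "\<lambda>m. - _ m"] by simp
lift_definition scaleR_ell2 :: "real \<Rightarrow> 'a ell2 \<Rightarrow> 'a ell2" is "\<lambda>r f m. r *\<^sub>R f m"
  by (simp add: power_mult_distrib summable_on_cmult_right)

instance
  by standard (transfer; simp add: algebra_simps fun_eq_iff)+

end

lemma ell2_nth_simps [simp]:
  "ell2_nth 0 m = 0"
  "ell2_nth (x + y) m = ell2_nth x m + ell2_nth y m"
  "ell2_nth (x - y) m = ell2_nth x m - ell2_nth y m"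
  "ell2_nth (- x) m = - ell2_nth x m"
  "ell2_nth (r *\<^sub>R x) m = r *\<^sub>R ell2_nth x m"
  by (transfer, simp)+

lemma ell2_nth_sum: "ell2_nth (\<Sum>i\<in>I. f i) m = (\<Sum>i\<in>I. ell2_nth (f i) m)"
  by (induction I rule: infinite_finite_induct) auto

text \<open>By polarization the summand is half of |x + y|^2 - |x|^2 - |y|^2 taken coordinatewise, a
  combination of three summable families.\<close>

lemma ell2_inner_summable:
  "(\<lambda>m. inner (ell2_nth x m) (ell2_nth y m)) summable_on UNIV"
proof -
  have "(\<lambda>m. 1/2 * ((cmod (ell2_nth (x + y) m))\<^sup>2 + - (cmod (ell2_nth x m))\<^sup>2 + - (cmod (ell2_nth y m))\<^sup>2))
    summable_on UNIV"
    by (intro summable_on_cmult_right summable_on_add summable_on_uminus[THEN iffD2] ell2_nth_summable)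
  then show ?thesis
    by (simp add: dot_norm)
qed

instantiation ell2 :: (type) real_inner
begin

definition inner_ell2 :: "'a ell2 \<Rightarrow> 'a ell2 \<Rightarrow> real" where
  "inner_ell2 x y = (\<Sum>\<^sub>\<infinity>m. inner (ell2_nth x m) (ell2_nth y m))"
definition norm_ell2 :: "'a ell2 \<Rightarrow> real" where
  "norm_ell2 x = sqrt (inner x x)"
definition dist_ell2 :: "'a ell2 \<Rightarrow> 'a ell2 \<Rightarrow> real" where
  "dist_ell2 x y = norm (x - y)"
definition sgn_ell2 :: "'a ell2 \<Rightarrow> 'a ell2" where
  "sgn_ell2 x = x /\<^sub>R norm x"
definition uniformity_ell2 :: "('a ell2 \<times> 'a ell2) filter" where
  "uniformity_ell2 = (INF e\<in>{0 <..}. principal {(x, y). dist x y < e})"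
definition open_ell2 :: "'a ell2 set \<Rightarrow> bool" where
  "open_ell2 U = (\<forall>x\<in>U. \<forall>\<^sub>F (x', y) in uniformity. x' = x \<longrightarrow> y \<in> U)"

instance
proof
  fix x y z :: "'a ell2" and r :: real
  show "inner x y = inner y x"
    by (simp add: inner_ell2_def inner_commute)
  show "inner (x + y) z = inner x z + inner y z"
    by (simp add: inner_ell2_def inner_add_left infsum_add ell2_inner_summable)
  show "inner (r *\<^sub>R x) y = r * inner x y"
    by (simp add: inner_ell2_def infsum_cmult_right')
  show "0 \<le> inner x x"
    by (simp add: inner_ell2_def infsum_nonneg)
  show "inner x x = 0 \<longleftrightarrow> x = 0"
  proof
    assume "inner x x = 0"
    then have "inner (ell2_nth x m) (ell2_nth x m) = 0" for m
      using ell2_inner_summable[of x x] unfolding inner_ell2_def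
      by (intro nonneg_infsum_le_0D[where A=UNIV and f = "\<lambda>m. inner (ell2_nth x m) (ell2_nth x m)"]) auto
    then show "x = 0" by (intro ell2_eqI) simp
  qed (simp add: inner_ell2_def)
qed (simp_all add: dist_ell2_def sgn_ell2_def uniformity_ell2_def open_ell2_def norm_ell2_def)

end

section \<open>Coordinates, completeness and domination in \<open>ell2\<close>\<close>

lemma norm_ell2_power2: "(norm x)\<^sup>2 = (\<Sum>\<^sub>\<infinity>m. (cmod (ell2_nth x m))\<^sup>2)"
  by (simp add: power2_norm_eq_inner inner_ell2_def)

lemma sum_le_norm_ell2:
  assumes "finite F"
  shows "(\<Sum>m\<in>F. (cmod (ell2_nth x m))\<^sup>2) \<le> (norm x)\<^sup>2"
  unfolding norm_ell2_power2
  by (rule finite_sum_le_infsum) (use assms ell2_nth_summable in auto)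

text \<open>Controls the supremum by the Hilbert norm; with weights at least 1 this turns norm
  bounds into pointwise bounds that deactivate the truncation.\<close>

lemma cmod_ell2_nth_le: "cmod (ell2_nth x m) \<le> norm x"
  using sum_le_norm_ell2[of "{m}" x] by (simp add: power2_le_iff_abs_le)

lemma bounded_linear_ell2_nth: "bounded_linear (\<lambda>x. ell2_nth x m)"
  by (rule bounded_linear_intro[of _ 1]) (simp_all add: cmod_ell2_nth_le)

text \<open>Membership and norm bound are both read off from finite partial sums, so limits need to
  be interchanged with finite sums only.\<close>

lemma ell2_norm_boundI:
  assumes "0 \<le> C" "\<And>F. finite F \<Longrightarrow> (\<Sum>m\<in>F. (cmod (f m))\<^sup>2) \<le> C\<^sup>2"
  obtains x where "ell2_nth x = f" "norm x \<le> C"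
proof -
  have s: "(\<lambda>m. (cmod (f m))\<^sup>2) summable_on UNIV"
    by (rule nonneg_bdd_above_summable_on) (use assms(2) in \<open>auto intro!: bdd_aboveI2\<close>)
  define x where "x = Abs_ell2 f"
  have x: "ell2_nth x = f" using s by (simp add: x_def Abs_ell2_inverse)
  have "(norm x)\<^sup>2 \<le> C\<^sup>2"
    unfolding norm_ell2_power2 x by (rule infsum_le_finite_sums[OF s]) (use assms in auto)
  then have "norm x \<le> C" using assms(1) by (rule power2_le_imp_le)
  with x show ?thesis by (rule that)
qed

instance ell2 :: (type) banach
proof
  fix X :: "nat \<Rightarrow> 'a ell2"
  assume X: "Cauchy X"
  have "Cauchy (\<lambda>n. ell2_nth (X n) m)" for m
    by (rule bounded_linear.Cauchy[OF bounded_linear_ell2_nth X])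
  then have "\<forall>m. \<exists>l. (\<lambda>n. ell2_nth (X n) m) \<longlonglongrightarrow> l"
    by (simp add: Cauchy_convergent_iff convergent_def)
  then obtain l where l: "\<And>m. (\<lambda>n. ell2_nth (X n) m) \<longlonglongrightarrow> l m" by metis
  \<comment> \<open>A Fatou-type argument: over a finite set the bound for \<open>X n - X k\<close>
    survives the coordinatewise limit in \<open>k\<close>.\<close>
  have tail: "\<exists>x. ell2_nth x = (\<lambda>m. ell2_nth (X n) m - l m) \<and> norm x \<le> e"
    if "0 < e" and N: "\<And>k. k \<ge> N \<Longrightarrow> dist (X n) (X k) < e" for e N n
  proof -
    have "(\<Sum>m\<in>F. (cmod (ell2_nth (X n) m - l m))\<^sup>2) \<le> e\<^sup>2" if F: "finite F" for F
    proof (rule LIMSEQ_le_const2)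
      show "(\<lambda>k. \<Sum>m\<in>F. (cmod (ell2_nth (X n) m - ell2_nth (X k) m))\<^sup>2)
        \<longlonglongrightarrow> (\<Sum>m\<in>F. (cmod (ell2_nth (X n) m - l m))\<^sup>2)"
        by (intro tendsto_intros l)
      have "(\<Sum>m\<in>F. (cmod (ell2_nth (X n) m - ell2_nth (X k) m))\<^sup>2) \<le> e\<^sup>2" if "k \<ge> N" for k
      proof -
        have "(\<Sum>m\<in>F. (cmod (ell2_nth (X n - X k) m))\<^sup>2) \<le> (norm (X n - X k))\<^sup>2"
          by (rule sum_le_norm_ell2[OF F])
        also have "\<dots> \<le> e\<^sup>2"
          using N[OF that] by (intro power_mono) (auto simp: dist_norm)
        finally show ?thesis by simp
      qed
      then show "\<exists>N. \<forall>k\<ge>N. (\<Sum>m\<in>F. (cmod (ell2_nth (X n) m - ell2_nth (X k) m))\<^sup>2) \<le> e\<^sup>2"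
        by blast
    qed
    then show ?thesis
      using \<open>0 < e\<close> by (metis ell2_norm_boundI less_imp_le)
  qed
  \<comment> \<open>A single tail estimate places the pointwise limit in the space:
    \<open>x0\<close> represents \<open>X N0\<close> minus the limit, so the limit is
    \<open>X N0 - x0\<close>.\<close>
  obtain N0 where "\<And>m n. m \<ge> N0 \<Longrightarrow> n \<ge> N0 \<Longrightarrow> dist (X m) (X n) < 1"
    using X unfolding Cauchy_def by (metis zero_less_one)
  then obtain x0 where x0: "ell2_nth x0 = (\<lambda>m. ell2_nth (X N0) m - l m)"
    using tail[where e = 1 and N = N0 and n = N0] by auto
  have L: "ell2_nth (X N0 - x0) m = l m" for m
    by (simp add: x0)
  have "X \<longlonglongrightarrow> X N0 - x0"
  proof (rule metric_LIMSEQ_I)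
    fix e :: real assume "0 < e"
    then obtain N where N: "\<And>m n. m \<ge> N \<Longrightarrow> n \<ge> N \<Longrightarrow> dist (X m) (X n) < e / 2"
      using X unfolding Cauchy_def by (metis half_gt_zero)
    have "dist (X n) (X N0 - x0) < e" if "n \<ge> N" for n
    proof -
      obtain x where x: "ell2_nth x = (\<lambda>m. ell2_nth (X n) m - l m)" "norm x \<le> e / 2"
        using tail[where e = "e / 2" and N = N and n = n] N[OF \<open>n \<ge> N\<close>] \<open>0 < e\<close> by auto
      have "x = X n - (X N0 - x0)"
        by (rule ell2_eqI) (simp only: ell2_nth_simps(3)[of "X n" "X N0 - x0"] L, simp add: x)
      then show ?thesis using x(2) \<open>0 < e\<close> by (simp add: dist_norm)
    qed
    then show "\<exists>N. \<forall>n\<ge>N. dist (X n) (X N0 - x0) < e" by blast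
  qed
  then show "convergent X" by (rule convergentI)
qed

text \<open>The bijection \<open>h\<close> permits two uses: the identity for the pointwise
  nonlinearity, and a lattice translation for the shifts in the Laplacian.\<close>

lemma ell2_dominated:
  assumes h: "bij h" and "0 \<le> C" and le: "\<And>m. cmod (f m) \<le> C * cmod (ell2_nth x (h m))"
  obtains y where "ell2_nth y = f" "norm y \<le> C * norm x"
proof (rule ell2_norm_boundI)
  show "0 \<le> C * norm x" using \<open>0 \<le> C\<close> by simp
  fix F :: "'a set" assume F: "finite F"
  have "(\<Sum>m\<in>F. (cmod (f m))\<^sup>2) \<le> (\<Sum>m\<in>F. (C * cmod (ell2_nth x (h m)))\<^sup>2)"
    by (intro sum_mono power_mono le) simp
  also have "\<dots> = C\<^sup>2 * (\<Sum>m\<in>h ` F. (cmod (ell2_nth x m))\<^sup>2)"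
    using bij_is_inj[OF h]
    by (simp add: power_mult_distrib sum_distrib_left sum.reindex inj_on_subset)
  also have "\<dots> \<le> C\<^sup>2 * (norm x)\<^sup>2"
    using F by (intro mult_left_mono sum_le_norm_ell2) auto
  finally show "(\<Sum>m\<in>F. (cmod (f m))\<^sup>2) \<le> (C * norm x)\<^sup>2"
    by (simp add: power_mult_distrib)
qed (rule that)

subsection \<open>Ordinary differential equations with a Lipschitz right-hand side\<close>

text \<open>The product of E with exp (- C t) has nonpositive derivative.\<close>

lemma gronwall_exp:
  fixes E :: "real \<Rightarrow> real"
  assumes der: "\<And>t. t \<in> {0..T} \<Longrightarrow> (E has_real_derivative E' t) (at t within {0..T})"
    and le: "\<And>t. t \<in> {0..T} \<Longrightarrow> E' t \<le> C * E t"
    and t: "t \<in> {0..T}"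
  shows "E t \<le> exp (C * t) * E 0"
proof -
  define g where "g s = exp (- C * s) * E s" for s
  have g': "(g has_real_derivative exp (- C * s) * (E' s - C * E s)) (at s within {0..T})"
    if "s \<in> {0..T}" for s
    unfolding g_def
    by (rule derivative_eq_intros der that refl | simp add: algebra_simps)+
  have "g t \<le> g 0"
  proof (rule DERIV_nonpos_imp_decreasing_open[of 0 t])
    fix s assume s: "0 < s" "s < t"
    \<comment> \<open>The derivatives are one-sided only at the endpoints, where continuity suffices
      for monotonicity.\<close>
    then have "at s within {0..T} = at s"
      using t by (intro at_within_interior) auto
    moreover have "exp (- C * s) * (E' s - C * E s) \<le> 0"
      using le[of s] s t by (intro mult_nonneg_nonpos) auto
    ultimately show "\<exists>y. DERIV g s :> y \<and> y \<le> 0"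
      using g'[of s] s t by auto
  next
    show "continuous_on {0..t} g"
      by (rule continuous_on_subset[of "{0..T}"], rule DERIV_continuous_on[OF g'])
        (use t in auto)
  qed (use t in auto)
  then show ?thesis
    by (simp add: g_def exp_minus field_simps)
qed

lemma has_real_derivative_inner_self:
  assumes "(x has_vector_derivative x') (at t within S)"
  shows "((\<lambda>t. inner (x t) (x t)) has_real_derivative 2 * inner (x t) x') (at t within S)"
  unfolding has_field_derivative_def
  using has_derivative_inner[OF assms[unfolded has_vector_derivative_def] assms[unfolded has_vector_derivative_def]]
  by (rule has_derivative_eq_rhs) (auto simp: inner_commute)

text \<open>In an inner product space the squared distance of two solutions is differentiable; it
  starts at 0 and grows at rate at most 2 L.\<close>

lemma lipschitz_ode_unique:
  fixes F :: "'a::real_inner \<Rightarrow> 'a"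
  assumes L: "\<And>x y. norm (F x - F y) \<le> L * norm (x - y)"
    and x: "\<And>t. t \<in> {0..T} \<Longrightarrow> (x has_vector_derivative F (x t)) (at t within {0..T})"
    and y: "\<And>t. t \<in> {0..T} \<Longrightarrow> (y has_vector_derivative F (y t)) (at t within {0..T})"
    and "x 0 = y 0" and t: "t \<in> {0..T}"
  shows "x t = y t"
proof -
  define E where "E s = inner (x s - y s) (x s - y s)" for s
  have E': "(E has_real_derivative 2 * inner (x s - y s) (F (x s) - F (y s))) (at s within {0..T})"
    if "s \<in> {0..T}" for s
    unfolding E_def
    by (intro has_real_derivative_inner_self has_vector_derivative_diff x y that)
  have "E t \<le> exp (2 * L * t) * E 0"
  proof (rule gronwall_exp[OF E' _ t])
    fix s assume "s \<in> {0..T}"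
    have "inner (x s - y s) (F (x s) - F (y s)) \<le> norm (x s - y s) * norm (F (x s) - F (y s))"
      by (rule norm_cauchy_schwarz)
    also have "\<dots> \<le> norm (x s - y s) * (L * norm (x s - y s))"
      by (intro mult_left_mono L) simp
    also have "\<dots> = L * E s"
      by (simp add: E_def flip: power2_norm_eq_inner power2_eq_square)
    finally show "2 * inner (x s - y s) (F (x s) - F (y s)) \<le> 2 * L * E s" by simp
  qed
  then have "E t \<le> 0" using \<open>x 0 = y 0\<close> by (simp add: E_def)
  then show ?thesis by (simp add: E_def flip: power2_norm_eq_inner)
qed

text \<open>In the unknown \<open>exp (- \<lambda> t) x t\<close> with \<open>\<lambda>\<close> twice the Lipschitz constant, the Picard map is a
  contraction on the whole interval at once.\<close>

lemma lipschitz_ode_exists: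
  fixes F :: "'a::banach \<Rightarrow> 'a"
  assumes L: "\<And>x y. norm (F x - F y) \<le> L * norm (x - y)" and "0 \<le> T"
  obtains x where "x 0 = x0"
    "\<And>t. t \<in> {0..T} \<Longrightarrow> (x has_vector_derivative F (x t)) (at t within {0..T})"
proof -
  \<comment> \<open>A positive constant avoids a case distinction on the sign of
    \<open>L\<close>.\<close>
  define K where "K = max L 1"
  have K: "K > 0" by (simp add: K_def)
  have KF: "norm (F x - F y) \<le> K * norm (x - y)" for x y
    by (rule order_trans[OF L]) (simp add: K_def mult_right_mono)
  have "K-lipschitz_on UNIV F"
    using K KF by (intro lipschitz_onI) (auto simp: dist_norm)
  then have F_cont: "continuous_on A (\<lambda>s. F (f s))" if "continuous_on A f" for A and f :: "real \<Rightarrow> 'a"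
    using continuous_on_compose2[OF lipschitz_on_continuous_on that] by auto
  define h where "h y t = exp (- (2 * K * t)) *\<^sub>R (x0 + integral {0..t} (\<lambda>s. F (exp (2 * K * s) *\<^sub>R y s)))"
    for y :: "real \<Rightarrow> 'a" and t
  \<comment> \<open>Clamping time to the interval extends a curve to a bounded continuous function
    on the line, so the complete space \<open>bcontfun\<close> can carry the Picard map.\<close>
  define c where "c t = max 0 (min T t)" for t :: real
  have c: "c t \<in> {0..T}" for t using \<open>0 \<le> T\<close> by (auto simp: c_def)
  have c_id: "c t = t" if "t \<in> {0..T}" for t using that by (auto simp: c_def)
  have integrand_cont: "continuous_on A (\<lambda>s. F (exp (2 * K * s) *\<^sub>R apply_bcontfun y s))" for y A
    by (intro F_cont continuous_intros) auto
  have h_cont: "continuous_on {0..T} (h (apply_bcontfun y))" for y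
    unfolding h_def
    by (intro continuous_intros indefinite_integral_continuous_1 integrable_continuous_real integrand_cont)
  have hc: "(\<lambda>t. h (apply_bcontfun y) (c t)) \<in> bcontfun" for y
  proof -
    have "continuous_on UNIV (\<lambda>t. h (apply_bcontfun y) (c t))"
      by (rule continuous_on_compose2[OF h_cont]) (use c in \<open>auto simp: c_def intro!: continuous_intros\<close>)
    moreover have "bounded (h (apply_bcontfun y) ` {0..T})"
      by (intro compact_imp_bounded compact_continuous_image h_cont) auto
    then have "bounded (range (\<lambda>t. h (apply_bcontfun y) (c t)))"
      by (rule bounded_subset) (use c in auto)
    ultimately show ?thesis by (simp add: bcontfun_def)
  qed
  define P where "P y = Bcontfun (\<lambda>t. h (apply_bcontfun y) (c t))" for y
  have P: "apply_bcontfun (P y) t = h (apply_bcontfun y) (c t)" for y t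
    by (simp add: P_def Bcontfun_inverse hc)
  have "dist (P y) (P z) \<le> 1/2 * dist y z" for y z
  proof (rule dist_bound)
    fix t
    define d where "d = dist y z"
    define e where "e s = exp (2 * K * s)" for s
    let ?I = "\<lambda>y. integral {0..c t} (\<lambda>s. F (e s *\<^sub>R apply_bcontfun y s))"
    have int: "(\<lambda>s. F (e s *\<^sub>R apply_bcontfun y s)) integrable_on {0..c t}" for y
      unfolding e_def by (intro integrable_continuous_real integrand_cont)
    \<comment> \<open>Integration of the exponential of rate 2 K against the Lipschitz constant K
      leaves the factor 1/2, which becomes the contraction constant once the weight at
      \<open>c t\<close> is divided out.\<close>
    have dominating: "((\<lambda>s. K * (e s * d)) has_integral d / 2 * e (c t) - d / 2 * e 0) {0..c t}"
      using c[of t] unfolding e_def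
      by (intro fundamental_theorem_of_calculus)
        (auto intro!: derivative_eq_intros simp flip: has_real_derivative_iff_has_vector_derivative)
    have "norm (?I y - ?I z) = norm (integral {0..c t} (\<lambda>s. F (e s *\<^sub>R apply_bcontfun y s) - F (e s *\<^sub>R apply_bcontfun z s)))"
      by (simp add: integral_diff int)
    also have "\<dots> \<le> integral {0..c t} (\<lambda>s. K * (e s * d))"
    proof (rule integral_norm_bound_integral)
      show "norm (F (e s *\<^sub>R apply_bcontfun y s) - F (e s *\<^sub>R apply_bcontfun z s)) \<le> K * (e s * d)" for s
      proof -
        have "norm (e s *\<^sub>R apply_bcontfun y s - e s *\<^sub>R apply_bcontfun z s)
          = e s * dist (apply_bcontfun y s) (apply_bcontfun z s)"
          by (simp add: e_def dist_norm flip: scaleR_diff_right)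
        also have "\<dots> \<le> e s * d"
          by (intro mult_left_mono) (auto simp: d_def e_def dist_bounded)
        finally show ?thesis
          using KF[of "e s *\<^sub>R apply_bcontfun y s" "e s *\<^sub>R apply_bcontfun z s"] K
          by (meson mult_left_mono less_imp_le order_trans)
      qed
    qed (use dominating int in \<open>auto intro!: integrable_diff\<close>)
    also have "\<dots> = d / 2 * e (c t) - d / 2 * e 0"
      using dominating by (rule integral_unique)
    also have "\<dots> \<le> d / 2 * e (c t)" by (simp add: d_def e_def)
    finally have "exp (- (2 * K * c t)) * norm (?I y - ?I z) \<le> exp (- (2 * K * c t)) * (d / 2 * e (c t))"
      by (intro mult_left_mono) auto
    also have "\<dots> = d / 2" by (simp add: e_def exp_minus)
    also have "exp (- (2 * K * c t)) * norm (?I y - ?I z) = dist (apply_bcontfun (P y) t) (apply_bcontfun (P z) t)"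
      by (simp add: P h_def dist_norm e_def flip: scaleR_diff_right)
    finally show "dist (apply_bcontfun (P y) t) (apply_bcontfun (P z) t) \<le> 1/2 * dist y z"
      by (simp add: d_def)
  qed
  then have "\<exists>!y. P y = y"
    by (intro banach_fix_type[of "1/2"]) auto
  then obtain y where y: "P y = y" by blast
  define x where "x t = exp (2 * K * t) *\<^sub>R apply_bcontfun y t" for t
  have x: "x t = x0 + integral {0..t} (\<lambda>s. F (x s))" if "t \<in> {0..T}" for t
  proof -
    have "apply_bcontfun y t = h (apply_bcontfun y) t"
      using P[of y t] y c_id[OF that] by simp
    then show ?thesis by (simp add: x_def h_def flip: exp_add)
  qed
  show ?thesis
  proof (rule that)
    show "x 0 = x0" using x[of 0] \<open>0 \<le> T\<close> by simp
    fix t assume t: "t \<in> {0..T}"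
    have "((\<lambda>t. x0 + integral {0..t} (\<lambda>s. F (x s))) has_vector_derivative F (x t)) (at t within {0..T})"
      using integral_has_vector_derivative[OF _ t, of "\<lambda>s. F (x s)"] integrand_cont
      by (auto simp: x_def has_vector_derivative_def intro!: derivative_eq_intros)
    from has_vector_derivative_transform[OF t x this]
    show "(x has_vector_derivative F (x t)) (at t within {0..T})"
      by blast
  qed
qed

subsection \<open>The truncated power nonlinearity\<close>

definition trunc_rate :: "real \<Rightarrow> real \<Rightarrow> real \<Rightarrow> real" where
  "trunc_rate p R r = min r R powr (p - 1)"

definition trunc_power :: "real \<Rightarrow> real \<Rightarrow> complex \<Rightarrow> complex" where
  "trunc_power p R z = trunc_rate p R (cmod z) *\<^sub>R z"

text \<open>Integrating in the variable \<open>q = r\<^sup>2\<close> makes the potential a smooth function of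
  \<open>(cmod z)\<^sup>2\<close>, so that the origin is not exceptional.\<close>

definition trunc_potential :: "real \<Rightarrow> real \<Rightarrow> complex \<Rightarrow> real" where
  "trunc_potential p R z = 1/2 * integral {0..(cmod z)\<^sup>2} (\<lambda>q. trunc_rate p R (sqrt \<bar>q\<bar>))"

lemma trunc_rate_nonneg: "0 \<le> trunc_rate p R r"
  by (simp add: trunc_rate_def)

lemma trunc_rate_mono:
  assumes "1 < p" "0 < R" "0 \<le> r" "r \<le> s"
  shows "trunc_rate p R r \<le> trunc_rate p R s"
  unfolding trunc_rate_def using assms by (intro powr_mono2) auto

lemma trunc_rate_le:
  assumes "1 < p" "0 < R" "0 \<le> r"
  shows "trunc_rate p R r \<le> R powr (p - 1)"
  unfolding trunc_rate_def using assms by (intro powr_mono2) auto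

text \<open>A bound on r k'(r) for the rate k, in integrated form. The factor \<open>r\<close>
  compensates the derivative (p - 1) r^(p - 2), which is unbounded near the origin when p <
  2.\<close>

lemma trunc_rate_diff_le:
  assumes p: "1 < p" and R: "0 < R" and "0 \<le> r" "r \<le> s"
  shows "(trunc_rate p R s - trunc_rate p R r) * r \<le> (p - 1) * R powr (p - 1) * (s - r)"
proof (cases "0 < r \<and> r < min s R")
  case False
  then consider "r = 0" | "r = s" | "R \<le> r" using assms by linarith
  then show ?thesis
  proof cases
    assume "R \<le> r"
    then have "trunc_rate p R s = trunc_rate p R r"
      using \<open>r \<le> s\<close> by (simp add: trunc_rate_def)
    then show ?thesis using assms by simp
  qed (use assms in auto)
next
  case True
  \<comment> \<open>The rate is constant beyond \<open>R\<close>, so only the part of the interval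
    below \<open>R\<close> contributes.\<close>
  define s' where "s' = min s R"
  have "\<exists>z>r. z < s' \<and> s' powr (p - 1) - r powr (p - 1) = (s' - r) * ((p - 1) * z powr (p - 1 - 1))"
  proof (rule MVT2)
    show "((\<lambda>a. a powr (p - 1)) has_real_derivative (p - 1) * a powr (p - 1 - 1)) (at a)"
      if "r \<le> a" for a
      using that True by (intro has_real_derivative_powr) auto
  qed (use True s'_def in auto)
  then obtain z where z: "r < z" "z < s'"
    and eq: "s' powr (p - 1) - r powr (p - 1) = (s' - r) * ((p - 1) * z powr (p - 2))"
    by auto
  have "(trunc_rate p R s - trunc_rate p R r) * r = (p - 1) * (s' - r) * (r * z powr (p - 2))"
  proof -
    have "trunc_rate p R s = s' powr (p - 1)" "trunc_rate p R r = r powr (p - 1)"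
      using True by (auto simp: trunc_rate_def s'_def min_def split: if_splits)
    with eq show ?thesis by simp
  qed
  also have "\<dots> \<le> (p - 1) * (s' - r) * (R powr (p - 1))"
  proof (intro mult_left_mono)
    \<comment> \<open>Replacing \<open>r\<close> by the larger intermediate point \<open>z\<close>
      first makes the exponent p - 1, which is positive and hence monotone.\<close>
    have "r * z powr (p - 2) \<le> z powr 1 * z powr (p - 2)"
      using z True by (intro mult_right_mono) auto
    also have "\<dots> = z powr (p - 1)"
      using z True powr_add[of z 1 "p - 2"] by simp
    also have "\<dots> \<le> R powr (p - 1)"
      using z True p s'_def by (intro powr_mono2) auto
    finally show "r * z powr (p - 2) \<le> R powr (p - 1)" .
  qed (use z p in auto)
  also have "\<dots> \<le> (p - 1) * (s - r) * (R powr (p - 1))"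
    using p by (intro mult_right_mono mult_left_mono) (auto simp: s'_def)
  finally show ?thesis by (simp add: mult_ac)
qed

text \<open>With b the argument of smaller modulus and k the rate, the difference splits into k(|a|)
  (a - b) and (k(|a|) - k(|b|)) b. The two parts contribute the factors 1 and p - 1 of R^(p -
  1).\<close>

lemma trunc_power_lipschitz:
  assumes p: "1 < p" and R: "0 < R"
  shows "cmod (trunc_power p R a - trunc_power p R b) \<le> p * R powr (p - 1) * cmod (a - b)"
proof -
  have *: "cmod (trunc_power p R a - trunc_power p R b) \<le> p * R powr (p - 1) * cmod (a - b)"
    if le: "cmod b \<le> cmod a" for a b
  proof -
    let ?k = "trunc_rate p R"
    have "trunc_power p R a - trunc_power p R b
      = ?k (cmod a) *\<^sub>R (a - b) + (?k (cmod a) - ?k (cmod b)) *\<^sub>R b"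
      by (simp add: trunc_power_def algebra_simps)
    then have "cmod (trunc_power p R a - trunc_power p R b)
      \<le> ?k (cmod a) * cmod (a - b) + (?k (cmod a) - ?k (cmod b)) * cmod b"
      using norm_triangle_ineq[of "?k (cmod a) *\<^sub>R (a - b)" "(?k (cmod a) - ?k (cmod b)) *\<^sub>R b"]
        trunc_rate_mono[OF p R _ le] trunc_rate_nonneg[of p R "cmod a"] by simp
    also have "\<dots> \<le> R powr (p - 1) * cmod (a - b) + (p - 1) * R powr (p - 1) * (cmod a - cmod b)"
      using p R le by (intro add_mono mult_right_mono trunc_rate_le trunc_rate_diff_le) auto
    also have "\<dots> \<le> R powr (p - 1) * cmod (a - b) + (p - 1) * R powr (p - 1) * cmod (a - b)"
      using p by (intro add_left_mono mult_left_mono norm_triangle_ineq2) auto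
    also have "\<dots> = p * R powr (p - 1) * cmod (a - b)" by (simp add: algebra_simps)
    finally show ?thesis .
  qed
  show ?thesis
    using *[of a b] *[of b a] by (metis linear norm_minus_commute)
qed

lemma trunc_power_0 [simp]: "trunc_power p R 0 = 0"
  by (simp add: trunc_power_def)

lemma trunc_power_eq:
  "cmod z \<le> R \<Longrightarrow> trunc_power p R z = of_real (cmod z powr (p - 1)) * z"
  by (simp add: trunc_power_def trunc_rate_def scaleR_conv_of_real)

section \<open>The potential of the truncated nonlinearity\<close>

lemma continuous_on_trunc_rate_sqrt:
  assumes "1 < p" "0 < R"
  shows "continuous_on A (\<lambda>q. trunc_rate p R (sqrt \<bar>q\<bar>))"
  unfolding trunc_rate_def
  by (intro continuous_on_powr' continuous_intros) (use assms in auto)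

lemma trunc_potential_nonneg:
  assumes "1 < p" "0 < R"
  shows "0 \<le> trunc_potential p R z"
  unfolding trunc_potential_def
  using integral_nonneg[OF integrable_continuous_real[OF continuous_on_trunc_rate_sqrt[OF assms]]]
  by (simp add: trunc_rate_nonneg)

text \<open>The rate is nondecreasing, so the integrand is at most its value at the upper
  endpoint.\<close>

lemma trunc_potential_le:
  assumes "1 < p" "0 < R"
  shows "trunc_potential p R z \<le> 1/2 * trunc_rate p R (cmod z) * (cmod z)\<^sup>2"
proof -
  have "integral {0..(cmod z)\<^sup>2} (\<lambda>q. trunc_rate p R (sqrt \<bar>q\<bar>))
    \<le> integral {0..(cmod z)\<^sup>2} (\<lambda>q. trunc_rate p R (cmod z))"
    by (intro integral_le integrable_continuous_real continuous_on_trunc_rate_sqrt trunc_rate_mono)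
      (use assms in \<open>auto intro: real_le_lsqrt\<close>)
  then show ?thesis by (simp add: trunc_potential_def mult_ac)
qed

text \<open>Identifies \<open>trunc_power\<close> as the gradient of the potential: the chain rule
  through the squared modulus produces a factor 2, which the 1/2 in the potential cancels.\<close>

lemma trunc_potential_line_derivative:
  fixes z h :: complex
  assumes p: "1 < p" and R: "0 < R"
  shows "((\<lambda>s. trunc_potential p R (z + s *\<^sub>R h)) has_real_derivative
    inner (trunc_power p R (z + s *\<^sub>R h)) h) (at s)"
proof -
  let ?k = "\<lambda>q. trunc_rate p R (sqrt \<bar>q\<bar>)"
  \<comment> \<open>Integrating from -1 makes q = 0 an interior point, so the derivative there is
    two-sided. The absolute value under the square root keeps the integrand continuous on the
    negative side.\<close>
  define H where "H q = integral {-1..q} ?k" for q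
  have int: "?k integrable_on {a..b}" for a b
    by (intro integrable_continuous_real continuous_on_trunc_rate_sqrt p R)
  have H': "(H has_real_derivative ?k q) (at q)" if "0 \<le> q" for q
  proof -
    have "(H has_real_derivative ?k q) (at q within {-1..q + 1})"
      unfolding H_def
      by (rule integral_has_real_derivative) (use that p R in \<open>auto intro: continuous_on_trunc_rate_sqrt\<close>)
    moreover have "at q within {-1..q + 1} = at q"
      using that by (intro at_within_interior) auto
    ultimately show ?thesis by simp
  qed
  have pot: "trunc_potential p R y = 1/2 * (H ((cmod y)\<^sup>2) - H 0)" for y
    unfolding trunc_potential_def H_def
    using Henstock_Kurzweil_Integration.integral_combine[of "-1" 0 "(cmod y)\<^sup>2" ?k] int by simp
  have quad: "(cmod (z + s *\<^sub>R h))\<^sup>2 = (cmod z)\<^sup>2 + 2 * s * inner z h + s\<^sup>2 * (cmod h)\<^sup>2" for s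
    unfolding power2_norm_eq_inner
    by (simp add: inner_add_left inner_add_right inner_commute power2_eq_square algebra_simps)
  have q': "((\<lambda>s. (cmod (z + s *\<^sub>R h))\<^sup>2) has_real_derivative 2 * inner (z + s *\<^sub>R h) h) (at s)"
    unfolding quad
    by (rule derivative_eq_intros refl | simp add: inner_add_left power2_norm_eq_inner)+
  have "((\<lambda>s. trunc_potential p R (z + s *\<^sub>R h)) has_real_derivative
    1/2 * (?k ((cmod (z + s *\<^sub>R h))\<^sup>2) * (2 * inner (z + s *\<^sub>R h) h) - 0)) (at s)"
    unfolding pot
    by (intro DERIV_cmult DERIV_diff DERIV_const DERIV_chain2[OF H' q']) simp
  then show ?thesis by (simp add: trunc_power_def)
qed

text \<open>The mean value theorem on the segment and the Lipschitz bound for the gradient give a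
  quadratic remainder. Its constant does not depend on \<open>z\<close>, so it can be summed over
  the lattice.\<close>

lemma trunc_potential_taylor:
  fixes z h :: complex
  assumes p: "1 < p" and R: "0 < R"
  shows "\<bar>trunc_potential p R (z + h) - trunc_potential p R z - inner (trunc_power p R z) h\<bar>
    \<le> p * R powr (p - 1) * (cmod h)\<^sup>2"
proof -
  define G where "G s = trunc_potential p R (z + s *\<^sub>R h) - s * inner (trunc_power p R z) h" for s
  have "DERIV G s :> inner (trunc_power p R (z + s *\<^sub>R h) - trunc_power p R z) h" for s
    unfolding G_def
    by (rule derivative_eq_intros trunc_potential_line_derivative p R refl | simp add: inner_diff_left)+
  then obtain s where s: "0 < s" "s < 1"
    and eq: "G 1 - G 0 = (1 - 0) * inner (trunc_power p R (z + s *\<^sub>R h) - trunc_power p R z) h"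
    using MVT2[of 0 1 G "\<lambda>s. inner (trunc_power p R (z + s *\<^sub>R h) - trunc_power p R z) h"] by auto
  have "\<bar>inner (trunc_power p R (z + s *\<^sub>R h) - trunc_power p R z) h\<bar>
    \<le> cmod (trunc_power p R (z + s *\<^sub>R h) - trunc_power p R z) * cmod h"
    by (rule Cauchy_Schwarz_ineq2)
  also have "\<dots> \<le> p * R powr (p - 1) * cmod (s *\<^sub>R h) * cmod h"
    using trunc_power_lipschitz[OF p R, of "z + s *\<^sub>R h" z] by (intro mult_right_mono) auto
  also have "\<dots> \<le> p * R powr (p - 1) * (cmod h)\<^sup>2"
    using s p by (simp add: power2_eq_square mult_left_le_one_le mult_right_mono mult_left_mono)
  finally show ?thesis using eq by (simp add: G_def)
qed

section \<open>Nonlinearity and potential on \<open>ell2\<close>, conjugated by the weight\<close>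

definition weighted_trunc :: "real \<Rightarrow> real \<Rightarrow> ('a \<Rightarrow> real) \<Rightarrow> 'a ell2 \<Rightarrow> 'a ell2" where
  "weighted_trunc p R w x = Abs_ell2 (\<lambda>m. w m *\<^sub>R trunc_power p R (ell2_nth x m /\<^sub>R w m))"

definition weighted_potential :: "real \<Rightarrow> real \<Rightarrow> ('a \<Rightarrow> real) \<Rightarrow> 'a ell2 \<Rightarrow> real" where
  "weighted_potential p R w x = (\<Sum>\<^sub>\<infinity>m. (w m)\<^sup>2 * trunc_potential p R (ell2_nth x m /\<^sub>R w m))"

context
  fixes p R :: real and w :: "'a \<Rightarrow> real"
  assumes p: "1 < p" and R: "0 < R" and w: "\<And>m. 1 \<le> w m"
begin

lemma weight_function_pos: "0 < w m" using w[of m] by simp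

text \<open>The weight outside and its inverse inside cancel, so the constant is independent of
  \<open>w\<close>.\<close>

lemma weighted_trunc_power_lipschitz:
  "cmod (w m *\<^sub>R trunc_power p R (a /\<^sub>R w m) - w m *\<^sub>R trunc_power p R (b /\<^sub>R w m))
    \<le> p * R powr (p - 1) * cmod (a - b)"
proof -
  have "cmod (w m *\<^sub>R trunc_power p R (a /\<^sub>R w m) - w m *\<^sub>R trunc_power p R (b /\<^sub>R w m))
    = w m * cmod (trunc_power p R (a /\<^sub>R w m) - trunc_power p R (b /\<^sub>R w m))"
    using weight_function_pos[of m] by (simp flip: scaleR_diff_right)
  also have "\<dots> \<le> w m * (p * R powr (p - 1) * cmod (a /\<^sub>R w m - b /\<^sub>R w m))"
    using weight_function_pos[of m] by (intro mult_left_mono trunc_power_lipschitz p R) auto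
  also have "cmod (a /\<^sub>R w m - b /\<^sub>R w m) = cmod (a - b) / w m"
    using weight_function_pos[of m] by (simp add: divide_inverse mult.commute flip: scaleR_diff_right)
  finally show ?thesis using weight_function_pos[of m] by simp
qed

text \<open>Establishes the square-summability that \<open>Abs_ell2\<close> presupposes: the
  Lipschitz bound against 0 dominates the image by a multiple of \<open>x\<close>.\<close>

lemma weighted_trunc_nth:
  "ell2_nth (weighted_trunc p R w x) m = w m *\<^sub>R trunc_power p R (ell2_nth x m /\<^sub>R w m)"
proof -
  obtain y where "ell2_nth y = (\<lambda>m. w m *\<^sub>R trunc_power p R (ell2_nth x m /\<^sub>R w m))"
    by (rule ell2_dominated[of id "p * R powr (p - 1)" "\<lambda>m. w m *\<^sub>R trunc_power p R (ell2_nth x m /\<^sub>R w m)" x])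
      (use weighted_trunc_power_lipschitz[where b = 0] p in auto)
  then show ?thesis
    unfolding weighted_trunc_def by (metis ell2_nth_inverse)
qed

lemma weighted_trunc_lipschitz:
  "norm (weighted_trunc p R w x - weighted_trunc p R w y) \<le> p * R powr (p - 1) * norm (x - y)"
proof -
  obtain z where "ell2_nth z = ell2_nth (weighted_trunc p R w x - weighted_trunc p R w y)"
    "norm z \<le> p * R powr (p - 1) * norm (x - y)"
    by (rule ell2_dominated[of id "p * R powr (p - 1)"
          "ell2_nth (weighted_trunc p R w x - weighted_trunc p R w y)" "x - y"])
      (use weighted_trunc_power_lipschitz p in \<open>auto simp: weighted_trunc_nth\<close>)
  then show ?thesis by (simp add: ell2_nth_inject)
qed

text \<open>Either alternative bounds the capped modulus by \<open>M\<close>. Taking M = R gives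
  summability for every \<open>x\<close>; taking M above the norm of \<open>x\<close> gives a bound
  that does not depend on \<open>R\<close>.\<close>

lemma weighted_potential_term_le:
  assumes "norm x \<le> M \<or> R \<le> M"
  shows "(w m)\<^sup>2 * trunc_potential p R (ell2_nth x m /\<^sub>R w m)
    \<le> 1/2 * M powr (p - 1) * (cmod (ell2_nth x m))\<^sup>2"
proof -
  let ?z = "ell2_nth x m /\<^sub>R w m"
  have z: "cmod ?z = cmod (ell2_nth x m) / w m"
    using weight_function_pos[of m] by (simp add: divide_inverse mult.commute)
  also have "\<dots> \<le> cmod (ell2_nth x m)"
    using w[of m] by (simp add: divide_le_eq mult_left_le mult_le_cancel_left1)
  also have "\<dots> \<le> norm x" by (rule cmod_ell2_nth_le)
  finally have "trunc_rate p R (cmod ?z) \<le> M powr (p - 1)"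
    unfolding trunc_rate_def using assms p R by (intro powr_mono2) auto
  then have "trunc_potential p R ?z \<le> 1/2 * M powr (p - 1) * (cmod ?z)\<^sup>2"
    by (intro order_trans[OF trunc_potential_le[OF p R]] mult_right_mono) auto
  then have "(w m)\<^sup>2 * trunc_potential p R ?z \<le> (w m)\<^sup>2 * (1/2 * M powr (p - 1) * (cmod ?z)\<^sup>2)"
    by (intro mult_left_mono) auto
  also have "\<dots> = 1/2 * M powr (p - 1) * (cmod (ell2_nth x m))\<^sup>2"
    unfolding z using weight_function_pos[of m] by (simp add: power_divide)
  finally show ?thesis .
qed

lemma weighted_potential_summable:
  "(\<lambda>m. (w m)\<^sup>2 * trunc_potential p R (ell2_nth x m /\<^sub>R w m)) summable_on UNIV"
  by (rule summable_on_comparison_test[OF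
        summable_on_cmult_right[OF ell2_nth_summable[of x], where c = "1/2 * R powr (p - 1)"]])
    (use weighted_potential_term_le[of x R] trunc_potential_nonneg[OF p R] in auto)

lemma weighted_potential_nonneg: "0 \<le> weighted_potential p R w x"
  unfolding weighted_potential_def
  by (intro infsum_nonneg mult_nonneg_nonneg trunc_potential_nonneg p R) auto

lemma weighted_potential_le:
  assumes "norm x \<le> M"
  shows "weighted_potential p R w x \<le> 1/2 * M powr (p - 1) * (norm x)\<^sup>2"
  unfolding weighted_potential_def norm_ell2_power2
  by (subst infsum_cmult_right'[symmetric], intro infsum_mono weighted_potential_summable
      summable_on_cmult_right ell2_nth_summable weighted_potential_term_le)
    (use assms in auto)

text \<open>The scalar remainder bound is summed over all points; the squared weight in front
  cancels against the one in the squared increment.\<close>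

lemma weighted_potential_taylor:
  "\<bar>weighted_potential p R w (x + h) - weighted_potential p R w x - inner (weighted_trunc p R w x) h\<bar>
    \<le> p * R powr (p - 1) * (norm h)\<^sup>2"
proof -
  let ?V = "\<lambda>x m. (w m)\<^sup>2 * trunc_potential p R (ell2_nth x m /\<^sub>R w m)"
  let ?I = "\<lambda>m. inner (ell2_nth (weighted_trunc p R w x) m) (ell2_nth h m)"
  let ?D = "\<lambda>m. ?V (x + h) m + - ?V x m + - ?I m"
  have D_summable: "?D summable_on UNIV"
    by (intro summable_on_add summable_on_uminus[THEN iffD2] weighted_potential_summable ell2_inner_summable)
  have D: "infsum ?D UNIV = weighted_potential p R w (x + h) - weighted_potential p R w x
    - inner (weighted_trunc p R w x) h"
    unfolding weighted_potential_def inner_ell2_def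
    by (subst infsum_add, intro summable_on_add summable_on_uminus[THEN iffD2]
        weighted_potential_summable, intro summable_on_uminus[THEN iffD2] ell2_inner_summable,
        subst infsum_add, intro weighted_potential_summable,
        intro summable_on_uminus[THEN iffD2] weighted_potential_summable)
      (simp add: infsum_uminus)
  have D_le: "\<bar>?D m\<bar> \<le> p * R powr (p - 1) * (cmod (ell2_nth h m))\<^sup>2" for m
  proof -
    let ?z = "ell2_nth x m /\<^sub>R w m" and ?h = "ell2_nth h m /\<^sub>R w m"
    have "?D m = (w m)\<^sup>2 * (trunc_potential p R (?z + ?h) - trunc_potential p R ?z
      - inner (trunc_power p R ?z) ?h)"
      using weight_function_pos[of m]
      by (simp add: weighted_trunc_nth algebra_simps scaleR_add_right power2_eq_square)
    then have "\<bar>?D m\<bar> = (w m)\<^sup>2 * \<bar>trunc_potential p R (?z + ?h) - trunc_potential p R ?z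
      - inner (trunc_power p R ?z) ?h\<bar>"
      by (simp only: abs_mult abs_power2)
    also have "\<dots> \<le> (w m)\<^sup>2 * (p * R powr (p - 1) * (cmod ?h)\<^sup>2)"
      by (intro mult_left_mono trunc_potential_taylor p R) auto
    also have "\<dots> = p * R powr (p - 1) * (cmod (ell2_nth h m))\<^sup>2"
      using weight_function_pos[of m] by (simp add: power_mult_distrib field_simps)
    finally show ?thesis .
  qed
  have bound: "(\<lambda>m. p * R powr (p - 1) * (cmod (ell2_nth h m))\<^sup>2) summable_on UNIV"
    by (intro summable_on_cmult_right ell2_nth_summable)
  have "infsum ?D UNIV \<le> (\<Sum>\<^sub>\<infinity>m. p * R powr (p - 1) * (cmod (ell2_nth h m))\<^sup>2)"
    by (rule infsum_mono[OF D_summable bound]) (use D_le in \<open>auto simp: abs_le_iff\<close>)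
  moreover have "(\<Sum>\<^sub>\<infinity>m. - ?D m) \<le> (\<Sum>\<^sub>\<infinity>m. p * R powr (p - 1) * (cmod (ell2_nth h m))\<^sup>2)"
    by (rule infsum_mono[OF summable_on_uminus[THEN iffD2, OF D_summable] bound])
      (use D_le abs_le_iff in blast)
  ultimately show ?thesis
    unfolding D[symmetric] norm_ell2_power2 abs_le_iff
    by (simp only: infsum_cmult_right' infsum_uminus simp_thms)
qed

lemma weighted_potential_has_derivative:
  "(weighted_potential p R w has_derivative inner (weighted_trunc p R w x)) (at x within S)"
  unfolding has_derivative_iff_norm
proof
  show "bounded_linear (inner (weighted_trunc p R w x))"
    by (rule bounded_linear_inner_right)
  let ?r = "\<lambda>y. norm (weighted_potential p R w y - weighted_potential p R w x
      - inner (weighted_trunc p R w x) (y - x)) / norm (y - x)"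
  show "(?r \<longlongrightarrow> 0) (at x within S)"
  proof (rule tendsto_sandwich[where f = "\<lambda>_. 0"])
    show "((\<lambda>y. p * R powr (p - 1) * norm (y - x)) \<longlongrightarrow> 0) (at x within S)"
      by (rule tendsto_eq_intros refl | simp)+
    show "\<forall>\<^sub>F y in at x within S. ?r y \<le> p * R powr (p - 1) * norm (y - x)"
    proof (intro always_eventually allI)
      fix y
      \<comment> \<open>At y = x the quotient is 0 by the convention for division by zero.\<close>
      show "?r y \<le> p * R powr (p - 1) * norm (y - x)"
        using weighted_potential_taylor[of x "y - x"] p
        by (cases "y = x") (auto simp: divide_le_eq power2_eq_square mult.assoc)
    qed
  qed auto
qed

end

subsection \<open>The weighted space and the Laplacian in the unknown \<open>w u\<close>\<close>

definition weight :: "real \<Rightarrow> int ^ 'd \<Rightarrow> real" where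
  "weight \<kappa> m = japanese_bracket m powr \<kappa>"

definition to_ell2 :: "real \<Rightarrow> (int ^ 'd \<Rightarrow> complex) \<Rightarrow> (int ^ 'd) ell2" where
  "to_ell2 \<kappa> f = Abs_ell2 (\<lambda>m. weight \<kappa> m *\<^sub>R f m)"

definition of_ell2 :: "real \<Rightarrow> (int ^ 'd) ell2 \<Rightarrow> int ^ 'd \<Rightarrow> complex" where
  "of_ell2 \<kappa> x m = ell2_nth x m /\<^sub>R weight \<kappa> m"

lemma japanese_bracket_ge_1: "1 \<le> japanese_bracket m"
  by (simp add: japanese_bracket_def)

lemma weight_pos [simp]: "0 < weight \<kappa> m"
  using japanese_bracket_ge_1[of m] by (simp add: weight_def)

lemma weight_nonzero [simp]: "weight \<kappa> m \<noteq> 0"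
  using weight_pos[of \<kappa> m] by linarith

lemma abs_weight [simp]: "\<bar>weight \<kappa> m\<bar> = weight \<kappa> m"
  by (rule abs_of_pos) simp

lemma weight_ge_1: "0 \<le> \<kappa> \<Longrightarrow> 1 \<le> weight \<kappa> m"
  using japanese_bracket_ge_1[of m] by (simp add: weight_def ge_one_powr_ge_zero)

lemma cmod_weight: "(cmod (weight \<kappa> m *\<^sub>R z))\<^sup>2 = (cmod z)\<^sup>2 * japanese_bracket m powr (2 * \<kappa>)"
  by (simp add: power_mult_distrib weight_def power2_eq_square mult_ac flip: powr_add)

lemma ell2_nth_to_ell2:
  "f \<in> weighted_l2 \<kappa> \<Longrightarrow> ell2_nth (to_ell2 \<kappa> f) = (\<lambda>m. weight \<kappa> m *\<^sub>R f m)"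
  unfolding to_ell2_def weighted_l2_def by (intro Abs_ell2_inverse) (simp only: mem_Collect_eq cmod_weight)

lemma weight_of_ell2: "weight \<kappa> m *\<^sub>R of_ell2 \<kappa> x m = ell2_nth x m"
  by (simp add: of_ell2_def)

lemma of_ell2_to_ell2: "f \<in> weighted_l2 \<kappa> \<Longrightarrow> of_ell2 \<kappa> (to_ell2 \<kappa> f) = f"
  by (simp add: of_ell2_def ell2_nth_to_ell2 fun_eq_iff)

lemma of_ell2_mem: "of_ell2 \<kappa> x \<in> weighted_l2 \<kappa>"
  unfolding weighted_l2_def mem_Collect_eq cmod_weight[symmetric] weight_of_ell2
  by (rule ell2_nth_summable)

lemma weighted_l2_norm_of_ell2: "weighted_l2_norm \<kappa> (of_ell2 \<kappa> x) = norm x"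
  unfolding weighted_l2_norm_def cmod_weight[symmetric] weight_of_ell2 norm_ell2_power2[symmetric]
  by simp

lemma of_ell2_simps:
  "of_ell2 \<kappa> (x - y) m = of_ell2 \<kappa> x m - of_ell2 \<kappa> y m"
  "of_ell2 \<kappa> (r *\<^sub>R x) m = r *\<^sub>R of_ell2 \<kappa> x m"
  by (simp_all add: of_ell2_def scaleR_diff_right mult.commute)

lemma of_ell2_inject: "of_ell2 \<kappa> x = of_ell2 \<kappa> y \<longleftrightarrow> x = y"
  by (metis ell2_eqI weight_of_ell2)

lemma bounded_linear_of_ell2: "bounded_linear (\<lambda>x. of_ell2 \<kappa> x m)"
  unfolding of_ell2_def
  by (rule bounded_linear_compose[OF bounded_linear_scaleR_right bounded_linear_ell2_nth])

section \<open>Weights at neighbouring points and the conjugated Laplacian\<close>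

lemma lattice_norm_triangle: "lattice_norm (x + y) \<le> lattice_norm x + lattice_norm y"
proof -
  have "(\<chi> i. real_of_int ((x + y) $ i)) = (\<chi> i. real_of_int (x $ i)) + (\<chi> i. real_of_int (y $ i))"
    by (simp add: vec_eq_iff)
  then show ?thesis
    unfolding lattice_norm_def by (metis norm_triangle_ineq)
qed

lemma lattice_norm_minus: "lattice_norm (- x) = lattice_norm x"
proof -
  have "(\<chi> i. real_of_int ((- x) $ i)) = - (\<chi> i. real_of_int (x $ i))"
    by (simp add: vec_eq_iff)
  then show ?thesis
    unfolding lattice_norm_def by (metis norm_minus_cancel)
qed

lemma lattice_norm_nonneg: "0 \<le> lattice_norm x"
  by (simp add: lattice_norm_def)

lemma japanese_bracket_neighbour:
  assumes "lattice_norm e = 1"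
  shows "japanese_bracket m \<le> 2 * japanese_bracket (m + e)"
proof -
  have "lattice_norm m \<le> lattice_norm (m + e) + 1"
    using lattice_norm_triangle[of "m + e" "- e"] assms by (simp add: lattice_norm_minus)
  then have "1 + (lattice_norm m)\<^sup>2 \<le> 1 + (lattice_norm (m + e) + 1)\<^sup>2"
    by (simp add: lattice_norm_nonneg power_mono)
  also have "\<dots> \<le> 2\<^sup>2 * (1 + (lattice_norm (m + e))\<^sup>2)"
  proof -
    \<comment> \<open>The right side minus the left side is (a - 1)^2 + 2 a^2 + 1.\<close>
    have "0 \<le> (a - 1) * (a - 1) + 2 * (a * a)" for a :: real by simp
    from this[of "lattice_norm (m + e)"] show ?thesis
      by (simp add: power2_eq_square algebra_simps)
  qed
  finally show ?thesis
    unfolding japanese_bracket_def by (metis real_sqrt_le_iff real_sqrt_mult real_sqrt_abs abs_numeral)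
qed

lemma weight_neighbour:
  assumes "lattice_norm e = 1" "0 \<le> \<kappa>"
  shows "weight \<kappa> m \<le> 2 powr \<kappa> * weight \<kappa> (m + e)"
  using powr_mono2[OF assms(2) _ japanese_bracket_neighbour[OF assms(1), of m]]
    japanese_bracket_ge_1[of m] japanese_bracket_ge_1[of "m + e"]
  by (simp add: weight_def powr_mult)

definition weighted_shift :: "real \<Rightarrow> int ^ 'd \<Rightarrow> (int ^ 'd) ell2 \<Rightarrow> (int ^ 'd) ell2" where
  "weighted_shift \<kappa> e x = Abs_ell2 (\<lambda>m. weight \<kappa> m *\<^sub>R of_ell2 \<kappa> x (m + e))"

text \<open>Summing over displacements rather than neighbours makes the index set independent of the
  lattice point, so this is a sum of operators.\<close>

definition weighted_laplacian :: "real \<Rightarrow> (int ^ 'd) ell2 \<Rightarrow> (int ^ 'd) ell2" where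
  "weighted_laplacian \<kappa> x = (\<Sum>e | lattice_norm e = 1. weighted_shift \<kappa> e x - x)"

text \<open>Neighbouring weights differ at most by the factor 2^\<kappa>, so the conjugated
  translation is dominated by the plain one.\<close>

lemma weighted_shift_props:
  assumes "lattice_norm e = 1" "0 \<le> \<kappa>"
  shows ell2_nth_weighted_shift:
      "ell2_nth (weighted_shift \<kappa> e x) = (\<lambda>m. weight \<kappa> m *\<^sub>R of_ell2 \<kappa> x (m + e))"
    and norm_weighted_shift_le: "norm (weighted_shift \<kappa> e x) \<le> 2 powr \<kappa> * norm x"
proof -
  let ?f = "\<lambda>m. weight \<kappa> m *\<^sub>R of_ell2 \<kappa> x (m + e)"
  have *: "cmod (?f m) \<le> 2 powr \<kappa> * cmod (ell2_nth x (m + e))" for m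
  proof -
    have "cmod (?f m) \<le> 2 powr \<kappa> * weight \<kappa> (m + e) * cmod (of_ell2 \<kappa> x (m + e))"
      using weight_neighbour[OF assms, of m] weight_pos[of \<kappa> m] by (simp add: mult_right_mono)
    also have "\<dots> = 2 powr \<kappa> * cmod (weight \<kappa> (m + e) *\<^sub>R of_ell2 \<kappa> x (m + e))"
      by simp
    finally show ?thesis by (simp only: weight_of_ell2)
  qed
  obtain y where y: "ell2_nth y = ?f" "norm y \<le> 2 powr \<kappa> * norm x"
    by (rule ell2_dominated[of "\<lambda>m. m + e" "2 powr \<kappa>" ?f x]) (use * in \<open>auto simp: bij_plus_right\<close>)
  then have "weighted_shift \<kappa> e x = y"
    unfolding weighted_shift_def by (metis ell2_nth_inverse)
  with y show "ell2_nth (weighted_shift \<kappa> e x) = ?f" "norm (weighted_shift \<kappa> e x) \<le> 2 powr \<kappa> * norm x"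
    by simp_all
qed

lemma bounded_linear_weighted_shift:
  assumes "lattice_norm e = 1" "0 \<le> \<kappa>"
  shows "bounded_linear (weighted_shift \<kappa> e)"
proof (rule bounded_linear_intro)
  show "norm (weighted_shift \<kappa> e x) \<le> norm x * 2 powr \<kappa>" for x
    using norm_weighted_shift_le[OF assms] by (simp add: mult.commute)
qed (rule ell2_eqI, simp add: ell2_nth_weighted_shift[OF assms] of_ell2_def algebra_simps)+

lemma bounded_linear_weighted_laplacian:
  "0 \<le> \<kappa> \<Longrightarrow> bounded_linear (weighted_laplacian \<kappa>)"
  unfolding weighted_laplacian_def
  by (intro bounded_linear_sum bounded_linear_sub bounded_linear_weighted_shift bounded_linear_ident) auto

lemma of_ell2_weighted_laplacian:
  assumes "0 \<le> \<kappa>"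
  shows "of_ell2 \<kappa> (weighted_laplacian \<kappa> x) m = discrete_laplacian (of_ell2 \<kappa> x) m"
proof -
  have "of_ell2 \<kappa> (weighted_laplacian \<kappa> x) m
    = (\<Sum>e | lattice_norm e = 1. of_ell2 \<kappa> (weighted_shift \<kappa> e x - x) m)"
    unfolding weighted_laplacian_def of_ell2_def ell2_nth_sum scaleR_sum_right ..
  also have "\<dots> = (\<Sum>e | lattice_norm e = 1. of_ell2 \<kappa> x (m + e) - of_ell2 \<kappa> x m)"
    by (intro sum.cong refl)
      (simp add: of_ell2_simps, simp add: of_ell2_def[of _ "weighted_shift _ _ _"]
        ell2_nth_weighted_shift assms)
  also have "\<dots> = discrete_laplacian (of_ell2 \<kappa> x) m"
    unfolding discrete_laplacian_def
    by (rule sum.reindex_bij_witness[of _ "\<lambda>y. y - m" "\<lambda>e. m + e"]) auto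
  finally show ?thesis .
qed

text \<open>Weights at least 1 bound the modulus of the solution by the norm of \<open>x\<close>,
  hence by \<open>R\<close>, so the truncation is inactive. Since every \<open>R\<close> above the
  norm is allowed, the level may be changed along a bounded curve.\<close>

lemma wave_equation_iff:
  assumes p: "1 < p" and R: "0 < R" and \<kappa>: "0 \<le> \<kappa>" and x: "norm x \<le> R"
  shows "(\<forall>m. of_ell2 \<kappa> z m - discrete_laplacian (of_ell2 \<kappa> x) m
      = - (of_real (cmod (of_ell2 \<kappa> x m) powr (p - 1)) * of_ell2 \<kappa> x m))
    \<longleftrightarrow> z = weighted_laplacian \<kappa> x - weighted_trunc p R (weight \<kappa>) x"
proof -
  have "of_ell2 \<kappa> (weighted_trunc p R (weight \<kappa>) x) m
    = of_real (cmod (of_ell2 \<kappa> x m) powr (p - 1)) * of_ell2 \<kappa> x m" for m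
  proof -
    have "cmod (of_ell2 \<kappa> x m) \<le> cmod (ell2_nth x m)"
      using weight_ge_1[OF \<kappa>, of m] weight_of_ell2[of \<kappa> m x]
      by (metis abs_of_nonneg mult_le_cancel_right1 norm_ge_zero norm_scaleR not_le order_trans
          zero_le_one)
    also have "\<dots> \<le> R" using cmod_ell2_nth_le x by (rule order_trans)
    finally have "trunc_power p R (of_ell2 \<kappa> x m)
      = of_real (cmod (of_ell2 \<kappa> x m) powr (p - 1)) * of_ell2 \<kappa> x m"
      by (rule trunc_power_eq)
    then show ?thesis
      by (simp add: of_ell2_def weighted_trunc_nth[OF p R weight_ge_1[OF \<kappa>]])
  qed
  moreover have "z = weighted_laplacian \<kappa> x - weighted_trunc p R (weight \<kappa>) x \<longleftrightarrow>
    (\<forall>m. of_ell2 \<kappa> z m = of_ell2 \<kappa> (weighted_laplacian \<kappa> x) m - of_ell2 \<kappa> (weighted_trunc p R (weight \<kappa>) x) m)"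
    by (simp add: fun_eq_iff flip: of_ell2_simps of_ell2_inject[of \<kappa>])
  ultimately show ?thesis
    by (simp add: of_ell2_weighted_laplacian[OF \<kappa>] algebra_simps)
qed

subsection \<open>Differentiable curves in the weighted space\<close>

text \<open>Matches the difference quotient used for curves in the weighted space with the Frechet
  form of the derivative; they can disagree only at s = t, which the limit ignores.\<close>

lemma has_vector_derivative_iff_quotient:
  "(f has_vector_derivative f') (at t within S) \<longleftrightarrow>
    ((\<lambda>s. norm ((f s - f t) /\<^sub>R (s - t) - f')) \<longlongrightarrow> 0) (at t within S)"
proof -
  have "norm ((f s - f t) /\<^sub>R (s - t) - f') = norm ((f s - f t) - (s - t) *\<^sub>R f') / norm (s - t)"
    if "s \<noteq> t" for s
  proof -
    have "(f s - f t) /\<^sub>R (s - t) - f' = ((f s - f t) - (s - t) *\<^sub>R f') /\<^sub>R (s - t)"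
      using that by (simp add: scaleR_diff_right)
    then show ?thesis by (simp add: divide_inverse mult.commute)
  qed
  then show ?thesis
    unfolding has_vector_derivative_def has_derivative_iff_norm
    by (simp add: bounded_linear_scaleR_left cong: Lim_cong_within)
qed

lemma has_weighted_l2_derivative_on_of_ell2:
  "has_weighted_l2_derivative_on \<kappa> S (\<lambda>t. of_ell2 \<kappa> (X t)) (\<lambda>t. of_ell2 \<kappa> (V t)) \<longleftrightarrow>
    (\<forall>t\<in>S. (X has_vector_derivative V t) (at t within S))"
  unfolding has_weighted_l2_derivative_on_def has_vector_derivative_iff_quotient
    of_ell2_simps[symmetric] weighted_l2_norm_of_ell2
  by (simp add: of_ell2_mem)

lemma has_weighted_l2_derivative_on_cong:
  assumes "\<And>t. t \<in> S \<Longrightarrow> u t = u' t" "\<And>t. t \<in> S \<Longrightarrow> v t = v' t"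
  shows "has_weighted_l2_derivative_on \<kappa> S u v \<longleftrightarrow> has_weighted_l2_derivative_on \<kappa> S u' v'"
  unfolding has_weighted_l2_derivative_on_def
  by (intro conj_cong ball_cong refl Lim_cong_within) (simp_all add: assms)

lemma weighted_l2_continuous_on_cong:
  assumes "\<And>t. t \<in> S \<Longrightarrow> u t = v t"
  shows "weighted_l2_continuous_on \<kappa> S u \<longleftrightarrow> weighted_l2_continuous_on \<kappa> S v"
  unfolding weighted_l2_continuous_on_def
  by (intro conj_cong ball_cong refl Lim_cong_within) (simp_all add: assms)

lemma weighted_l2_continuous_on_of_ell2:
  "weighted_l2_continuous_on \<kappa> S (\<lambda>t. of_ell2 \<kappa> (X t)) \<longleftrightarrow> continuous_on S X"
  unfolding weighted_l2_continuous_on_def of_ell2_simps[symmetric] weighted_l2_norm_of_ell2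
    continuous_on_def tendsto_norm_zero_iff LIM_zero_iff
  by (simp add: of_ell2_mem)

text \<open>Evaluation at a lattice point is bounded and linear, so it commutes with the derivative
  in norm. Positive length of the interval makes one-sided derivatives unique.\<close>

lemma time_derivative_of_ell2:
  assumes "0 < T" and t: "t \<in> {0..T}"
    and u: "\<And>s. s \<in> {0..T} \<Longrightarrow> u s = of_ell2 \<kappa> (X s)"
    and X: "(X has_vector_derivative V) (at t within {0..T})"
  shows "time_derivative T u t = of_ell2 \<kappa> V"
proof
  fix m
  have "((\<lambda>s. of_ell2 \<kappa> (X s) m) has_vector_derivative of_ell2 \<kappa> V m) (at t within {0..T})"
    by (rule bounded_linear.has_vector_derivative[OF bounded_linear_of_ell2 X])
  then have "((\<lambda>s. u s m) has_vector_derivative of_ell2 \<kappa> V m) (at t within {0..T})"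
    using t u by (auto intro: has_vector_derivative_transform)
  then show "time_derivative T u t m = of_ell2 \<kappa> V m"
    unfolding time_derivative_def by (rule vector_derivative_within_closed_interval[OF \<open>0 < T\<close> t])
qed

text \<open>For a curve with a known C^2 lift only the equation and the initial data remain.
  Existence and uniqueness use the two opposite directions.\<close>

lemma is_classical_solution_of_ell2:
  assumes T: "0 < T" and u: "\<And>t. t \<in> {0..T} \<Longrightarrow> u t = of_ell2 \<kappa> (X t)"
    and X: "\<And>t. t \<in> {0..T} \<Longrightarrow> (X has_vector_derivative Y t) (at t within {0..T})"
    and Y: "\<And>t. t \<in> {0..T} \<Longrightarrow> (Y has_vector_derivative Z t) (at t within {0..T})"
    and Z: "continuous_on {0..T} Z"
  shows "is_classical_solution p \<kappa> f g T u \<longleftrightarrow>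
    (\<forall>t\<in>{0..T}. \<forall>m. of_ell2 \<kappa> (Z t) m - discrete_laplacian (of_ell2 \<kappa> (X t)) m
      = - (of_real (cmod (of_ell2 \<kappa> (X t) m) powr (p - 1)) * of_ell2 \<kappa> (X t) m)) \<and>
    of_ell2 \<kappa> (X 0) = f \<and> of_ell2 \<kappa> (Y 0) = g"
proof -
  have "has_weighted_l2_derivative_on \<kappa> {0..T} u (\<lambda>t. of_ell2 \<kappa> (Y t))"
    using has_weighted_l2_derivative_on_of_ell2[of \<kappa> "{0..T}" X Y] X
      has_weighted_l2_derivative_on_cong[of "{0..T}" u "\<lambda>t. of_ell2 \<kappa> (X t)"] u by blast
  moreover have "has_weighted_l2_derivative_on \<kappa> {0..T} (\<lambda>t. of_ell2 \<kappa> (Y t)) (\<lambda>t. of_ell2 \<kappa> (Z t))"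
    using has_weighted_l2_derivative_on_of_ell2 Y by blast
  moreover have "weighted_l2_continuous_on \<kappa> {0..T} (\<lambda>t. of_ell2 \<kappa> (Z t))"
    using weighted_l2_continuous_on_of_ell2 Z by blast
  ultimately have C2: "u \<in> C2_weighted_l2 \<kappa> T"
    unfolding C2_weighted_l2_def by blast
  have D1: "time_derivative T u t = of_ell2 \<kappa> (Y t)" if "t \<in> {0..T}" for t
    by (rule time_derivative_of_ell2[OF T that u X[OF that]])
  have D2: "time_derivative T (time_derivative T u) t = of_ell2 \<kappa> (Z t)" if "t \<in> {0..T}" for t
    by (rule time_derivative_of_ell2[OF T that D1 Y[OF that]])
  show ?thesis
    unfolding is_classical_solution_def using C2 T by (simp add: D1 D2 u fun_eq_iff)
qed

text \<open>The carrier conditions let the curve and its derivatives be lifted by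
  \<open>to_ell2\<close>. The lift is faithful only on the interval, so the congruence rules are
  applied there.\<close>

lemma C2_weighted_l2E:
  assumes "u \<in> C2_weighted_l2 \<kappa> T"
  obtains X Y Z where
    "\<And>t. t \<in> {0..T} \<Longrightarrow> u t = of_ell2 \<kappa> (X t)"
    "\<And>t. t \<in> {0..T} \<Longrightarrow> (X has_vector_derivative Y t) (at t within {0..T})"
    "\<And>t. t \<in> {0..T} \<Longrightarrow> (Y has_vector_derivative Z t) (at t within {0..T})"
    "continuous_on {0..T} Z"
proof -
  let ?S = "{0..T}"
  obtain v w where uv: "has_weighted_l2_derivative_on \<kappa> ?S u v"
    and vw: "has_weighted_l2_derivative_on \<kappa> ?S v w" and w: "weighted_l2_continuous_on \<kappa> ?S w"
    using assms unfolding C2_weighted_l2_def by blast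
  have mem: "u t \<in> weighted_l2 \<kappa>" "v t \<in> weighted_l2 \<kappa>" "w t \<in> weighted_l2 \<kappa>" if "t \<in> ?S" for t
    using uv vw that unfolding has_weighted_l2_derivative_on_def by auto
  let ?lift = "\<lambda>u t. to_ell2 \<kappa> (u t)"
  have eq: "u t = of_ell2 \<kappa> (?lift u t)" "v t = of_ell2 \<kappa> (?lift v t)" "w t = of_ell2 \<kappa> (?lift w t)"
    if "t \<in> ?S" for t
    using mem[OF that] by (simp_all add: of_ell2_to_ell2)
  have "has_weighted_l2_derivative_on \<kappa> ?S (\<lambda>t. of_ell2 \<kappa> (?lift u t)) (\<lambda>t. of_ell2 \<kappa> (?lift v t))"
    by (rule has_weighted_l2_derivative_on_cong[THEN iffD1, OF _ _ uv]) (use eq in auto)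
  moreover have "has_weighted_l2_derivative_on \<kappa> ?S (\<lambda>t. of_ell2 \<kappa> (?lift v t)) (\<lambda>t. of_ell2 \<kappa> (?lift w t))"
    by (rule has_weighted_l2_derivative_on_cong[THEN iffD1, OF _ _ vw]) (use eq in auto)
  moreover have "weighted_l2_continuous_on \<kappa> ?S (\<lambda>t. of_ell2 \<kappa> (?lift w t))"
    by (rule weighted_l2_continuous_on_cong[THEN iffD1, OF _ w]) (use eq in auto)
  ultimately show ?thesis
    using that[of "?lift u" "?lift v" "?lift w"] eq(1)
    unfolding has_weighted_l2_derivative_on_of_ell2 weighted_l2_continuous_on_of_ell2 by blast
qed

subsection \<open>The truncated equation\<close>

text \<open>The vector field of the first-order system for the pair (x, x').\<close>

definition wave_field ::
  "real \<Rightarrow> real \<Rightarrow> real \<Rightarrow> (int ^ 'd) ell2 \<times> (int ^ 'd) ell2 \<Rightarrow> (int ^ 'd) ell2 \<times> (int ^ 'd) ell2" where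
  "wave_field p R \<kappa> z = (snd z, weighted_laplacian \<kappa> (fst z) - weighted_trunc p R (weight \<kappa>) (fst z))"

lemma wave_field_lipschitz:
  assumes p: "1 < p" and R: "0 < R" and \<kappa>: "0 \<le> \<kappa>"
  obtains L where
    "\<And>y z :: (int ^ 'd) ell2 \<times> (int ^ 'd) ell2.
      norm (wave_field p R \<kappa> y - wave_field p R \<kappa> z) \<le> L * norm (y - z)"
proof -
  interpret A: bounded_linear "weighted_laplacian \<kappa> :: (int ^ 'd) ell2 \<Rightarrow> _"
    by (rule bounded_linear_weighted_laplacian[OF \<kappa>])
  obtain B where B: "\<And>x :: (int ^ 'd) ell2. norm (weighted_laplacian \<kappa> x) \<le> norm x * B" "0 \<le> B"
    using A.nonneg_bounded by blast
  define L where "L = p * R powr (p - 1)"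
  \<comment> \<open>The 1 comes from the velocity component, \<open>B\<close> from the Laplacian and
    \<open>L\<close> from the truncated nonlinearity.\<close>
  have "norm (wave_field p R \<kappa> y - wave_field p R \<kappa> z) \<le> (1 + (B + L)) * norm (y - z)"
    for y z :: "(int ^ 'd) ell2 \<times> (int ^ 'd) ell2"
  proof -
    let ?N = "weighted_trunc p R (weight \<kappa>)"
    have fst_le: "norm (fst y - fst z) \<le> norm (y - z)" and snd_le: "norm (snd y - snd z) \<le> norm (y - z)"
      using dist_fst_le[of y z] dist_snd_le[of y z] by (simp_all add: dist_norm)
    have "wave_field p R \<kappa> y - wave_field p R \<kappa> z = (snd y - snd z,
        weighted_laplacian \<kappa> (fst y - fst z) - (?N (fst y) - ?N (fst z)))"
      by (simp add: wave_field_def A.diff)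
    then have "norm (wave_field p R \<kappa> y - wave_field p R \<kappa> z) \<le> norm (snd y - snd z)
      + norm (weighted_laplacian \<kappa> (fst y - fst z) - (?N (fst y) - ?N (fst z)))"
      by (simp add: norm_Pair_le)
    also have "\<dots> \<le> norm (snd y - snd z) + (norm (fst y - fst z) * B + L * norm (fst y - fst z))"
      using B weighted_trunc_lipschitz[OF p R, where w = "weight \<kappa>", OF weight_ge_1[OF \<kappa>]]
      unfolding L_def by (intro add_left_mono order_trans[OF norm_triangle_ineq4 add_mono])
    also have "\<dots> \<le> norm (y - z) + (norm (y - z) * B + L * norm (y - z))"
      using fst_le snd_le B(2) p by (intro add_mono mult_right_mono mult_left_mono) (auto simp: L_def)
    finally show ?thesis by (simp add: algebra_simps)
  qed
  then show ?thesis by (rule that)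
qed

text \<open>The term \<open>\<parallel>x\<parallel>\<^sup>2/2\<close> in the energy absorbs the Laplacian, so neither its sign nor its symmetry
  is needed and the growth rate does not see the truncation level.\<close>

lemma wave_field_bound:
  fixes z0 :: "(int ^ 'd) ell2 \<times> (int ^ 'd) ell2"
  assumes p: "1 < p" and \<kappa>: "0 \<le> \<kappa>"
  obtains M where "0 < M"
    "\<And>R z t. \<lbrakk>0 < R; z 0 = z0; t \<in> {0..T};
      \<And>t. t \<in> {0..T} \<Longrightarrow> (z has_vector_derivative wave_field p R \<kappa> (z t)) (at t within {0..T})\<rbrakk>
      \<Longrightarrow> norm (fst (z t)) \<le> M"
proof -
  interpret A: bounded_linear "weighted_laplacian \<kappa> :: (int ^ 'd) ell2 \<Rightarrow> _"
    by (rule bounded_linear_weighted_laplacian[OF \<kappa>])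
  obtain B where B: "\<And>x :: (int ^ 'd) ell2. norm (weighted_laplacian \<kappa> x) \<le> norm x * B" "0 \<le> B"
    using A.nonneg_bounded by blast
  \<comment> \<open>A bound for the initial energy at every truncation level: the last term is
    \<open>weighted_potential_le\<close> with M the norm of the initial position.\<close>
  define E0 where "E0 = (norm (snd z0))\<^sup>2 / 2 + (norm (fst z0))\<^sup>2 / 2
    + 1/2 * norm (fst z0) powr (p - 1) * (norm (fst z0))\<^sup>2"
  have E0: "0 \<le> E0" by (simp add: E0_def)
  have bound: "(norm (fst (z t)))\<^sup>2 \<le> 2 * exp ((B + 1) * T) * E0"
    if R: "0 < R" and z0: "z 0 = z0" and t: "t \<in> {0..T}"
      and z: "\<And>t. t \<in> {0..T} \<Longrightarrow> (z has_vector_derivative wave_field p R \<kappa> (z t)) (at t within {0..T})"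
    for R z t
  proof -
    note potential = p R weight_ge_1[OF \<kappa>]
    let ?V = "weighted_potential p R (weight \<kappa>)" and ?N = "weighted_trunc p R (weight \<kappa>)"
    let ?x = "\<lambda>t. fst (z t)" and ?y = "\<lambda>t. snd (z t)"
    define E where "E t = inner (?y t) (?y t) / 2 + inner (?x t) (?x t) / 2 + ?V (?x t)" for t
    \<comment> \<open>The nonlinearity is absent because its work on the velocity cancels against
      the derivative of the potential.\<close>
    define E' where "E' t = inner (?y t) (weighted_laplacian \<kappa> (?x t)) + inner (?x t) (?y t)" for t
    have V_nonneg: "0 \<le> ?V x" for x :: "(int ^ 'd) ell2"
      by (rule weighted_potential_nonneg[OF potential])
    have "(E has_real_derivative E' t) (at t within {0..T})" if t: "t \<in> {0..T}" for t
    proof -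
      have x': "(?x has_vector_derivative ?y t) (at t within {0..T})"
        and y': "(?y has_vector_derivative weighted_laplacian \<kappa> (?x t) - ?N (?x t)) (at t within {0..T})"
        using bounded_linear.has_vector_derivative[OF bounded_linear_fst z[OF t]]
          bounded_linear.has_vector_derivative[OF bounded_linear_snd z[OF t]]
        by (simp_all add: wave_field_def)
      have V': "((\<lambda>t. ?V (?x t)) has_real_derivative inner (?N (?x t)) (?y t)) (at t within {0..T})"
        unfolding has_field_derivative_def
        by (rule has_derivative_eq_rhs[OF has_derivative_in_compose[OF
                x'[unfolded has_vector_derivative_def] weighted_potential_has_derivative[OF potential]]])
          (simp add: fun_eq_iff)
      show ?thesis
        unfolding E_def
        by (rule DERIV_cong[OF DERIV_add[OF DERIV_add[OF
                DERIV_cdivide[OF has_real_derivative_inner_self[OF y']]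
                DERIV_cdivide[OF has_real_derivative_inner_self[OF x']]] V']])
          (simp add: E'_def inner_diff_right inner_commute diff_divide_distrib)
    qed
    moreover have "E' t \<le> (B + 1) * E t" for t
    proof -
      have "E' t \<le> norm (?y t) * (norm (?x t) * B) + norm (?x t) * norm (?y t)"
        unfolding E'_def
        by (intro add_mono order_trans[OF norm_cauchy_schwarz] mult_left_mono B) auto
      also have "\<dots> = (B + 1) * (norm (?x t) * norm (?y t))"
        by (simp add: algebra_simps)
      also have "\<dots> \<le> (B + 1) * ((norm (?y t))\<^sup>2 / 2 + (norm (?x t))\<^sup>2 / 2)"
        using B(2) sum_squares_bound[of "norm (?x t)" "norm (?y t)"] by (intro mult_left_mono) auto
      also have "\<dots> \<le> (B + 1) * E t"
        using B(2) V_nonneg by (intro mult_left_mono) (auto simp: E_def power2_norm_eq_inner)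
      finally show ?thesis .
    qed
    ultimately have "E t \<le> exp ((B + 1) * t) * E 0"
      by (rule gronwall_exp[OF _ _ t])
    also have "\<dots> \<le> exp ((B + 1) * T) * E0"
    proof (intro mult_mono)
      show "E 0 \<le> E0"
        using weighted_potential_le[OF potential order_refl, where x = "fst z0"]
        by (simp add: E_def E0_def z0 power2_norm_eq_inner)
      show "0 \<le> E 0" by (simp add: E_def V_nonneg)
    qed (use t B in \<open>auto intro: mult_left_mono\<close>)
    finally have "E t \<le> exp ((B + 1) * T) * E0" .
    then show ?thesis
      using V_nonneg[of "?x t"] inner_ge_zero[of "?y t"] unfolding E_def power2_norm_eq_inner by linarith
  qed
  show ?thesis
  \<comment> \<open>Adding 1 keeps the bound positive for zero data, as it later serves as a
    truncation level.\<close>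
  proof (rule that[of "sqrt (2 * exp ((B + 1) * T) * E0) + 1"])
    show "0 < sqrt (2 * exp ((B + 1) * T) * E0) + 1"
      using E0 by (simp add: add_nonneg_pos)
  next
    fix R z t
    assume "0 < R" "z 0 = z0" "t \<in> {0..T}"
      "\<And>t. t \<in> {0..T} \<Longrightarrow> (z has_vector_derivative wave_field p R \<kappa> (z t)) (at t within {0..T})"
    then have "norm (fst (z t)) \<le> sqrt (2 * exp ((B + 1) * T) * E0)"
      by (intro real_le_rsqrt bound)
    then show "norm (fst (z t)) \<le> sqrt (2 * exp ((B + 1) * T) * E0) + 1" by simp
  qed
qed

section \<open>Existence and uniqueness of the classical solution\<close>

lemma classical_solution_exists_unique:
  fixes f g :: "int ^ 'd \<Rightarrow> complex"
  assumes p: "1 < p" and \<kappa>: "0 \<le> \<kappa>" and f: "f \<in> weighted_l2 \<kappa>" and g: "g \<in> weighted_l2 \<kappa>" and T: "0 < T"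
  shows "\<exists>u. is_classical_solution p \<kappa> f g T u \<and>
    (\<forall>v. is_classical_solution p \<kappa> f g T v \<longrightarrow> (\<forall>t\<in>{0..T}. v t = u t))"
proof -
  define z0 where "z0 = (to_ell2 \<kappa> f, to_ell2 \<kappa> g)"
  obtain M where M: "0 < M" and apriori:
    "\<And>R z t. \<lbrakk>0 < R; z 0 = z0; t \<in> {0..T};
      \<And>t. t \<in> {0..T} \<Longrightarrow> (z has_vector_derivative wave_field p R \<kappa> (z t)) (at t within {0..T})\<rbrakk>
      \<Longrightarrow> norm (fst (z t)) \<le> M"
    using wave_field_bound[OF p \<kappa>, where T = T and ?z0.0 = z0] by blast
  obtain L where L: "\<And>y z :: (int ^ 'd) ell2 \<times> (int ^ 'd) ell2.
      norm (wave_field p M \<kappa> y - wave_field p M \<kappa> z) \<le> L * norm (y - z)"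
    using wave_field_lipschitz[OF p M \<kappa>] by blast
  obtain z where z0: "z 0 = z0" and z: "\<And>t. t \<in> {0..T} \<Longrightarrow>
      (z has_vector_derivative wave_field p M \<kappa> (z t)) (at t within {0..T})"
    by (rule lipschitz_ode_exists[OF L less_imp_le[OF T], of z0]) blast
  \<comment> \<open>The a priori bound holds at every level, in particular at level \<open>M\<close>
    itself; so the truncation at \<open>M\<close> is never active along \<open>z\<close>.\<close>
  have zM: "norm (fst (z t)) \<le> M" if "t \<in> {0..T}" for t
    by (rule apriori[OF M z0 that z])
  let ?Z = "\<lambda>R x. weighted_laplacian \<kappa> x - weighted_trunc p R (weight \<kappa>) x"
  let ?eq = "\<lambda>x z. \<forall>m. of_ell2 \<kappa> z m - discrete_laplacian (of_ell2 \<kappa> x) m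
      = - (of_real (cmod (of_ell2 \<kappa> x m) powr (p - 1)) * of_ell2 \<kappa> x m)"
  have fst': "((\<lambda>t. fst (z t)) has_vector_derivative snd (z t)) (at t within {0..T})"
    and snd': "((\<lambda>t. snd (z t)) has_vector_derivative ?Z M (fst (z t))) (at t within {0..T})"
    if "t \<in> {0..T}" for t
    using bounded_linear.has_vector_derivative[OF bounded_linear_fst z[OF that]]
      bounded_linear.has_vector_derivative[OF bounded_linear_snd z[OF that]]
    by (simp_all add: wave_field_def)
  \<comment> \<open>Continuity of the second derivative: it is a component of a Lipschitz field
    along a continuous curve.\<close>
  have "\<bar>L\<bar>-lipschitz_on UNIV (wave_field p M \<kappa> :: (int ^ 'd) ell2 \<times> (int ^ 'd) ell2 \<Rightarrow> _)"
    by (rule lipschitz_onI) (auto simp: dist_norm intro: order_trans[OF L mult_right_mono])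
  then have "continuous_on {0..T} (\<lambda>t. wave_field p M \<kappa> (z t))"
    by (rule continuous_on_compose2[OF lipschitz_on_continuous_on])
      (use continuous_on_vector_derivative[OF z] in auto)
  then have cont: "continuous_on {0..T} (\<lambda>t. ?Z M (fst (z t)))"
    using continuous_on_snd[of "{0..T}" "\<lambda>t. wave_field p M \<kappa> (z t)"] by (simp add: wave_field_def)
  define u where "u t = of_ell2 \<kappa> (fst (z t))" for t
  have u_eq: "?eq (fst (z t)) (?Z M (fst (z t)))" if "t \<in> {0..T}" for t
    using wave_equation_iff[OF p M \<kappa> zM[OF that]] by blast
  have "is_classical_solution p \<kappa> f g T u"
  proof (subst is_classical_solution_of_ell2[OF T u_def fst' snd' cont])
    show "(\<forall>t\<in>{0..T}. ?eq (fst (z t)) (?Z M (fst (z t)))) \<and> of_ell2 \<kappa> (fst (z 0)) = f \<and>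
      of_ell2 \<kappa> (snd (z 0)) = g"
      using u_eq by (intro conjI ballI) (simp_all add: z0 z0_def of_ell2_to_ell2 f g)
  qed
  moreover have "v t = u t" if v: "is_classical_solution p \<kappa> f g T v" and t: "t \<in> {0..T}" for v t
  proof -
    have "v \<in> C2_weighted_l2 \<kappa> T"
      using v by (simp add: is_classical_solution_def)
    then obtain X Y Z where vX: "\<And>t. t \<in> {0..T} \<Longrightarrow> v t = of_ell2 \<kappa> (X t)"
      and X: "\<And>t. t \<in> {0..T} \<Longrightarrow> (X has_vector_derivative Y t) (at t within {0..T})"
      and Y: "\<And>t. t \<in> {0..T} \<Longrightarrow> (Y has_vector_derivative Z t) (at t within {0..T})"
      and Z: "continuous_on {0..T} Z"
      by (rule C2_weighted_l2E) (rule that)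
    have "(\<forall>t\<in>{0..T}. ?eq (X t) (Z t)) \<and> of_ell2 \<kappa> (X 0) = f \<and> of_ell2 \<kappa> (Y 0) = g"
      by (rule is_classical_solution_of_ell2[THEN iffD1, OF T vX X Y Z v])
    then have eq: "\<And>t. t \<in> {0..T} \<Longrightarrow> ?eq (X t) (Z t)"
      and init: "of_ell2 \<kappa> (X 0) = f" "of_ell2 \<kappa> (Y 0) = g"
      by blast+
    have "bounded (X ` {0..T})"
      by (intro compact_imp_bounded compact_continuous_image continuous_on_vector_derivative[OF X]) auto
    then obtain K where K: "\<And>t. t \<in> {0..T} \<Longrightarrow> norm (X t) \<le> K"
      unfolding bounded_iff by blast
    \<comment> \<open>A common level above the bounds for both solutions, at which both solve the
      same truncated system.\<close>
    define R where "R = max M K"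
    have R: "0 < R" using M by (simp add: R_def)
    obtain L' where L': "\<And>y z :: (int ^ 'd) ell2 \<times> (int ^ 'd) ell2.
        norm (wave_field p R \<kappa> y - wave_field p R \<kappa> z) \<le> L' * norm (y - z)"
      using wave_field_lipschitz[OF p R \<kappa>] by blast
    have "(X t, Y t) = z t"
    proof (rule lipschitz_ode_unique[OF L' _ _ _ t])
      show "((\<lambda>t. (X t, Y t)) has_vector_derivative wave_field p R \<kappa> (X s, Y s)) (at s within {0..T})"
        if s: "s \<in> {0..T}" for s
      proof -
        have "norm (X s) \<le> R" using K[OF s] by (simp add: R_def)
        then have "Z s = ?Z R (X s)"
          using eq[OF s] wave_equation_iff[OF p R \<kappa>] by blast
        then show ?thesis
          using has_vector_derivative_Pair[OF X[OF s] Y[OF s]] by (simp add: wave_field_def)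
      qed
      show "(z has_vector_derivative wave_field p R \<kappa> (z s)) (at s within {0..T})"
        if s: "s \<in> {0..T}" for s
      proof -
        have "norm (fst (z s)) \<le> R" using zM[OF s] by (simp add: R_def)
        \<comment> \<open>Each side is characterized by the same untruncated equation, since both
          levels exceed the norm.\<close>
        then have "?Z M (fst (z s)) = ?Z R (fst (z s))"
          using u_eq[OF s] wave_equation_iff[OF p R \<kappa>] by blast
        then show ?thesis using z[OF s] by (simp only: wave_field_def)
      qed
      have "X 0 = to_ell2 \<kappa> f" "Y 0 = to_ell2 \<kappa> g"
        using init by (metis of_ell2_inject of_ell2_mem of_ell2_to_ell2)+
      then show "(X 0, Y 0) = z 0" by (simp add: z0 z0_def)
    qed
    then show ?thesis using vX[OF t] by (metis fst_conv u_def)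
  qed
  ultimately show ?thesis by blast
qed

theorem theorem1p7:
  fixes f g :: "int ^ 'd \<Rightarrow> complex" and p \<kappa> :: real
  assumes "p > 1" and "\<kappa> \<in> {0, 1}"
    and "f \<in> weighted_l2 \<kappa>" and "g \<in> weighted_l2 \<kappa>"
  shows "\<forall>T>0. \<exists>u. is_classical_solution p \<kappa> f g T u \<and>
           (\<forall>v. is_classical_solution p \<kappa> f g T v \<longrightarrow> (\<forall>t\<in>{0..T}. v t = u t))"
  using assms by (auto intro: classical_solution_exists_unique)

end
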